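(* Let $\mathcal{H}$ be a normalized complete Pick space on a set $X$. Then the zero sets for $\mathcal{H}$, the zero sets for $\mathrm{Mult}(\mathcal{H})$ and the zero sets for $N^+(\mathcal{H})$ agree. In particular, the union of two zero sets for $\mathcal{H}$ is a zero set for $\mathcal{H}$.
   Context: $\mathcal{H}$ is a reproducing kernel Hilbert space of complex-valued functions on a set $X$ with reproducing kernel $k$, and it is assumed that $k$ does not vanish on the diagonal. The multiplier algebra is $\mathrm{Mult}(\mathcal{H}) = \{\varphi : X \to \mathbb{C} : \varphi f \in \mathcal{H} \text{ for all } f \in \mathcal{H}\}$; each $\varphi \in \mathrm{Mult}(\mathcal{H})$ gives a bounded multiplication operator $M_\varphi$ on $\mathcal{H}$, and $\|\varphi\|_{\mathrm{Mult}(\mathcal{H})} = \|M_\varphi\|$. $\mathcal{H}$ is normalized if there is a point $x_0 \in X$ such that $k(x,x_0) = 1$ for all $x \in X$. $\mathcal{H}$ is a complete Pick space if for every $r \in \mathbb{N}$ and every finite collection of points $z_1,\ldots,z_n \in X$ and matrices $W_1,\ldots,W_n \in M_r(\mathbb{C})$, positive semidefiniteness of the $nr \times nr$ block matrix $[k(z_i,z_j)(I_{\mathbb{C}^r} - W_i W_j^* )]_{i,j=1}^n$ implies that there exists $\Phi \in M_r(\mathrm{Mult}(\mathcal{H}))$ of norm at most $1$ (as a multiplication operator on $\mathcal{H} \otimes \mathbb{C}^r$) with $\Phi(z_i) = W_i$ for $i=1,\ldots,n$. A multiplier $\psi$ is cyclic if $\psi\mathcal{H}$ is dense in $\mathcal{H}$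 (such a $\psi$ vanishes nowhere on $X$). The Smirnov class of $\mathcal{H}$ is $N^+(\mathcal{H}) = \{\varphi/\psi : \varphi,\psi \in \mathrm{Mult}(\mathcal{H}) \text{ and } \psi \text{ is cyclic}\}$. If $S$ is a class of functions on $X$, a subset $Z \subset X$ is a zero set for $S$ if there exists a function in $S$ that vanishes exactly on $Z$. *)

theory Defs
  imports Complex_Main "Jordan_Normal_Form.Schur_Decomposition"
begin

text \<open>
  The set on which the functions live is the type \<open>'x\<close>. A Hilbert function space is a set \<open>H\<close> of
  functions together with an inner product \<open>ip\<close>, which is only meaningful on \<open>H\<close>. Inner products
  are linear in the first argument, and \<open>k x y\<close> is the value at \<open>x\<close> of the kernel function at \<open>y\<close>.
\<close>

definition hnorm :: "(('x \<Rightarrow> complex) \<Rightarrow> ('x \<Rightarrow> complex) \<Rightarrow> complex) \<Rightarrow> ('x \<Rightarrow> complex) \<Rightarrow> real"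
  where "hnorm ip f = sqrt (Re (ip f f))"

text \<open>
  Boundedness of the point evaluations is not listed separately: it follows from the reproducing
  property by the Cauchy--Schwarz inequality. The kernel is uniquely determined by \<open>H\<close> and \<open>ip\<close>.
\<close>

locale rkhs =
  fixes H :: "('x \<Rightarrow> complex) set"
    and ip :: "('x \<Rightarrow> complex) \<Rightarrow> ('x \<Rightarrow> complex) \<Rightarrow> complex"
    and k :: "'x \<Rightarrow> 'x \<Rightarrow> complex"
  assumes zero_mem: "(\<lambda>x. 0) \<in> H"
    and add_mem: "\<lbrakk>f \<in> H; g \<in> H\<rbrakk> \<Longrightarrow> (\<lambda>x. f x + g x) \<in> H"
    and scale_mem: "f \<in> H \<Longrightarrow> (\<lambda>x. c * f x) \<in> H"
    and ip_add: "\<lbrakk>f \<in> H; g \<in> H; h \<in> H\<rbrakk> \<Longrightarrow> ip (\<lambda>x. f x + g x) h = ip f h + ip g h"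
    and ip_scale: "\<lbrakk>f \<in> H; h \<in> H\<rbrakk> \<Longrightarrow> ip (\<lambda>x. c * f x) h = c * ip f h"
    and ip_commute: "\<lbrakk>f \<in> H; g \<in> H\<rbrakk> \<Longrightarrow> ip g f = cnj (ip f g)"
    and ip_nonneg: "f \<in> H \<Longrightarrow> 0 \<le> Re (ip f f)"
    and ip_definite: "\<lbrakk>f \<in> H; ip f f = 0\<rbrakk> \<Longrightarrow> f = (\<lambda>x. 0)"
    and complete: "\<lbrakk>\<And>n. F n \<in> H;
        \<forall>e>0. \<exists>N. \<forall>m\<ge>N. \<forall>n\<ge>N. hnorm ip (\<lambda>x. F m x - F n x) < e\<rbrakk>
      \<Longrightarrow> \<exists>f\<in>H. (\<lambda>n. hnorm ip (\<lambda>x. F n x - f x)) \<longlonglongrightarrow> 0"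
    and kernel_mem: "(\<lambda>x. k x y) \<in> H"
    and reproducing: "f \<in> H \<Longrightarrow> f y = ip f (\<lambda>x. k x y)"

definition normalized_kernel :: "('x \<Rightarrow> 'x \<Rightarrow> complex) \<Rightarrow> bool"
  where "normalized_kernel k \<longleftrightarrow> (\<exists>x0. \<forall>x. k x x0 = 1)"

definition Mult :: "('x \<Rightarrow> complex) set \<Rightarrow> ('x \<Rightarrow> complex) set"
  where "Mult H = {\<phi>. \<forall>f\<in>H. (\<lambda>x. \<phi> x * f x) \<in> H}"

text \<open>
  On complex numbers, \<open>0 \<le> z\<close> means that \<open>z\<close> is real and nonnegative, so the condition below also
  forces the matrix to be Hermitian.
\<close>

definition psd_mat :: "complex mat \<Rightarrow> bool"
  where "psd_mat A \<longleftrightarrow> square_mat A \<and> (\<forall>v\<in>carrier_vec (dim_row A). 0 \<le> (A *\<^sub>v v) \<bullet>c v)"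

text \<open>
  The block matrix with the \<open>r \<times> r\<close> blocks \<open>k(z_i, z_j) (I - W_i W_j^*)\<close> for \<open>i, j < n\<close>: row
  \<open>a = i * r + s\<close> is row \<open>s\<close> of the \<open>i\<close>-th block row.
\<close>

definition pick_mat ::
    "('x \<Rightarrow> 'x \<Rightarrow> complex) \<Rightarrow> nat \<Rightarrow> nat \<Rightarrow> (nat \<Rightarrow> 'x) \<Rightarrow> (nat \<Rightarrow> complex mat) \<Rightarrow> complex mat"
  where "pick_mat k r n z W = mat (n * r) (n * r) (\<lambda>(a, b).
    k (z (a div r)) (z (b div r)) *
      (1\<^sub>m r - W (a div r) * mat_adjoint (W (b div r))) $$ (a mod r, b mod r))"

text \<open>
  An element of \<open>M_r(Mult(H))\<close> is an \<open>r \<times> r\<close> matrix of multipliers. It acts on the tensor product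
  of \<open>H\<close> with \<open>\<complex>^r\<close>, that is, on \<open>r\<close>-tuples \<open>F\<close> of elements of \<open>H\<close> with squared norm
  \<open>\<Sum>b<r. \<parallel>F b\<parallel>^2\<close>.
\<close>

definition contractive_mult_mat ::
    "('x \<Rightarrow> complex) set \<Rightarrow> (('x \<Rightarrow> complex) \<Rightarrow> ('x \<Rightarrow> complex) \<Rightarrow> complex) \<Rightarrow> nat \<Rightarrow>
      ('x \<Rightarrow> complex) mat \<Rightarrow> bool"
  where "contractive_mult_mat H ip r \<Phi> \<longleftrightarrow>
    \<Phi> \<in> carrier_mat r r \<and> elements_mat \<Phi> \<subseteq> Mult H \<and>
    (\<forall>F. (\<forall>b<r. F b \<in> H) \<longrightarrow>
      (\<Sum>a<r. (hnorm ip (\<lambda>x. \<Sum>b<r. (\<Phi> $$ (a, b)) x * F b x))\<^sup>2) \<le> (\<Sum>b<r. (hnorm ip (F b))\<^sup>2))"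

definition complete_pick ::
    "('x \<Rightarrow> complex) set \<Rightarrow> (('x \<Rightarrow> complex) \<Rightarrow> ('x \<Rightarrow> complex) \<Rightarrow> complex) \<Rightarrow>
      ('x \<Rightarrow> 'x \<Rightarrow> complex) \<Rightarrow> bool"
  where "complete_pick H ip k \<longleftrightarrow>
    (\<forall>r n. \<forall>z :: nat \<Rightarrow> 'x. \<forall>W :: nat \<Rightarrow> complex mat.
      (\<forall>i<n. W i \<in> carrier_mat r r) \<longrightarrow> psd_mat (pick_mat k r n z W) \<longrightarrow>
      (\<exists>\<Phi>. contractive_mult_mat H ip r \<Phi> \<and> (\<forall>i<n. map_mat (\<lambda>\<phi>. \<phi> (z i)) \<Phi> = W i)))"

definition cyclic_multiplier ::
    "('x \<Rightarrow> complex) set \<Rightarrow> (('x \<Rightarrow> complex) \<Rightarrow> ('x \<Rightarrow> complex) \<Rightarrow> complex) \<Rightarrow>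
      ('x \<Rightarrow> complex) \<Rightarrow> bool"
  where "cyclic_multiplier H ip \<psi> \<longleftrightarrow>
    \<psi> \<in> Mult H \<and> (\<forall>g\<in>H. \<forall>e>0. \<exists>f\<in>H. hnorm ip (\<lambda>x. \<psi> x * f x - g x) < e)"

text \<open>
  If the kernel has no zeros on the diagonal, a cyclic multiplier vanishes nowhere, so the quotients
  below never involve a division by zero.
\<close>

definition smirnov ::
    "('x \<Rightarrow> complex) set \<Rightarrow> (('x \<Rightarrow> complex) \<Rightarrow> ('x \<Rightarrow> complex) \<Rightarrow> complex) \<Rightarrow>
      ('x \<Rightarrow> complex) set"
  where "smirnov H ip =
    {(\<lambda>x. \<phi> x / \<psi> x) | \<phi> \<psi>. \<phi> \<in> Mult H \<and> \<psi> \<in> Mult H \<and> cyclic_multiplier H ip \<psi>}"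

definition zero_set :: "('x \<Rightarrow> complex) set \<Rightarrow> 'x set \<Rightarrow> bool"
  where "zero_set S Z \<longleftrightarrow> (\<exists>f\<in>S. {x. f x = 0} = Z)"

end

theory Submission
  imports Defs
begin

text \<open>
  Multiplying by \<open>1 = k(\<cdot>, x0)\<close> shows \<open>Mult H \<subseteq> H\<close>, a cyclic multiplier has no zeros, and products
  of multipliers are multipliers. So everything follows once each \<open>f \<in> H\<close> is shown to have the same
  zeros as some multiplier. For \<open>f \<noteq> 0\<close>, scaled so that \<open>\<parallel>f\<parallel> = 1\<close>, such a multiplier is explicit:
  \<open>\<phi>(w) = f(w) / \<langle>f, k_w f\<rangle>\<close>, where \<open>k_w = k(\<cdot>, w)\<close>.

  Why this \<open>\<phi>\<close> works. Put \<open>L = 1 - 1/k\<close>. By the theorem of McCullough and Quiggin, \<open>L\<close> is a positive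
  kernel, \<open>L(x, y) = \<Sum>_i b_i(x) cnj (b_i(y))\<close>, and then \<open>k (1 - L) = 1\<close> says that \<open>(b_i)_i\<close> is a
  contractive row of multipliers. Choose \<open>E_w = k_w (1 - cnj (\<phi>(w)) f)\<close>; the value of \<open>\<phi>(w)\<close> is the
  one that makes \<open>E_w\<close> orthogonal to \<open>f\<close>. With \<open>L_w = L(\<cdot>, w) = 1 - 1/k_w\<close> this gives
  \<open>1 + L_w E_w = E_w + cnj (\<phi>(w)) f\<close>. The Gram kernel of the right-hand side, at \<open>(z, w)\<close>, is
  \<open>\<langle>E_w, E_z\<rangle> + \<phi>(z) cnj (\<phi>(w))\<close>. On the left-hand side \<open>1\<close> is orthogonal to \<open>L_w E_w\<close>, which vanishes
  at \<open>x0\<close>, and the contractive row bounds the Gram kernel of the \<open>L_w E_w\<close> by \<open>L(z, w) \<langle>E_w, E_z\<rangle>\<close>.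
  Hence \<open>1 - \<phi>(z) cnj (\<phi>(w)) - (1 - L(z, w)) \<langle>E_w, E_z\<rangle>\<close> is a positive kernel. Multiplying by \<open>k\<close> and
  adding a Gram kernel, \<open>k(z, w) (1 - \<phi>(z) cnj (\<phi>(w)))\<close> is positive too, and so \<open>\<phi>\<close> is a multiplier.
  This is the lemma \<open>unit_vector_quotient\<close>. The same contractivity gives \<open>2 Re \<langle>f, k_w f\<rangle> \<ge> 1\<close>, so the
  denominator has no zeros.

  The complete Pick property enters only through matrices with a single nonzero row
  (\<open>row_interpolation\<close>), and is used in two ways. It shows that positivity of
  \<open>k(x, y) (1 - \<Sum>_l b_l(x) cnj (b_l(y)))\<close> makes \<open>b\<close> a contractive row (\<open>contractive_row_if_psd\<close>); the
  interpolants on finite sets are glued by a minimal-norm argument (\<open>mem_if_finitely_interpolated\<close>).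
  And it shows that \<open>L\<close> is positive: a contractive row stays contractive on the functions that
  vanish at a point \<open>p\<close>, whose kernel is \<open>k(x, y) - k(x, p) k(p, y) / k(p, p)\<close>, and this moves
  positivity of \<open>1 - k(x, p) k(p, y) / (k(p, p) k(x, y))\<close> from one base point \<open>p\<close> to any other
  (\<open>change_of_base\<close>), so that a set of points can be enlarged one point at a time.
\<close>

section \<open>Positive semidefinite kernels\<close>

definition qform :: "'x set \<Rightarrow> ('x \<Rightarrow> complex) \<Rightarrow> ('x \<Rightarrow> 'x \<Rightarrow> complex) \<Rightarrow> complex"
  where "qform F c K = (\<Sum>x\<in>F. \<Sum>y\<in>F. cnj (c x) * c y * K x y)"

text \<open>
  Finite sets of distinct points suffice instead of families of points: the coefficients of a repeated
  point add up to a single one.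
\<close>

definition psd_on :: "'x set \<Rightarrow> ('x \<Rightarrow> 'x \<Rightarrow> complex) \<Rightarrow> bool"
  where "psd_on T K \<longleftrightarrow> (\<forall>F c. finite F \<longrightarrow> F \<subseteq> T \<longrightarrow> 0 \<le> qform F c K)"

lemma psd_onI: "(\<And>F c. finite F \<Longrightarrow> F \<subseteq> T \<Longrightarrow> 0 \<le> qform F c K) \<Longrightarrow> psd_on T K"
  by (simp add: psd_on_def)

lemma psd_onD: "psd_on T K \<Longrightarrow> finite F \<Longrightarrow> F \<subseteq> T \<Longrightarrow> 0 \<le> qform F c K"
  by (simp add: psd_on_def)

lemma psd_on_mono: "psd_on T K \<Longrightarrow> S \<subseteq> T \<Longrightarrow> psd_on S K"
  unfolding psd_on_def by blast

lemma psd_on_finite_subsets: "(\<And>F. finite F \<Longrightarrow> F \<subseteq> T \<Longrightarrow> psd_on F K) \<Longrightarrow> psd_on T K"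
  unfolding psd_on_def by blast

lemma qform_cong:
  "(\<And>x y. x \<in> F \<Longrightarrow> y \<in> F \<Longrightarrow> cnj (c x) * c y * K x y = cnj (d x) * d y * L x y)
    \<Longrightarrow> qform F c K = qform F d L"
  unfolding qform_def by (intro sum.cong refl)

lemma psd_on_cong:
  assumes "psd_on T K" "\<And>x y. x \<in> T \<Longrightarrow> y \<in> T \<Longrightarrow> K x y = L x y"
  shows "psd_on T L"
proof (rule psd_onI)
  fix F c assume F: "finite F" "F \<subseteq> T"
  have "qform F c L = qform F c K"
    by (rule qform_cong) (use assms(2) F in \<open>simp add: subset_iff\<close>)
  then show "0 \<le> qform F c L" using psd_onD[OF assms(1) F] by simp
qed

lemma psd_on_add:
  assumes "psd_on T K" "psd_on T L"
  shows "psd_on T (\<lambda>x y. K x y + L x y)"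
proof (rule psd_onI)
  fix F c assume F: "finite F" "F \<subseteq> T"
  have "qform F c (\<lambda>x y. K x y + L x y) = qform F c K + qform F c L"
    unfolding qform_def by (simp add: distrib_left sum.distrib)
  then show "0 \<le> qform F c (\<lambda>x y. K x y + L x y)"
    using psd_onD[OF assms(1) F, of c] psd_onD[OF assms(2) F, of c] by simp
qed

lemma psd_on_zero: "psd_on T (\<lambda>x y. 0)"
  by (simp add: psd_on_def qform_def)

lemma psd_on_sum: "(\<And>l. l \<in> I \<Longrightarrow> psd_on T (K l)) \<Longrightarrow> psd_on T (\<lambda>x y. \<Sum>l\<in>I. K l x y)"
  by (induction I rule: infinite_finite_induct) (auto intro: psd_on_add psd_on_zero)

lemma psd_on_congruence:
  assumes "psd_on T K"
  shows "psd_on T (\<lambda>x y. a x * K x y * cnj (a y))"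
proof (rule psd_onI)
  fix F c assume F: "finite F" "F \<subseteq> T"
  have "qform F c (\<lambda>x y. a x * K x y * cnj (a y)) = qform F (\<lambda>x. cnj (a x) * c x) K"
    by (rule qform_cong) (simp add: mult_ac)
  then show "0 \<le> qform F c (\<lambda>x y. a x * K x y * cnj (a y))"
    using psd_onD[OF assms F] by simp
qed

lemma psd_on_one: "psd_on T (\<lambda>x y. 1)"
proof (rule psd_onI)
  fix F c
  have "qform F c (\<lambda>x y. 1) = cnj (sum c F) * sum c F"
    unfolding qform_def by (simp add: sum_product cnj_sum)
  also have "\<dots> = of_real ((cmod (sum c F))\<^sup>2)"
    using complex_norm_square[of "sum c F"] by (simp add: mult.commute)
  finally show "0 \<le> qform F c (\<lambda>x y. 1)"
    by (simp add: less_eq_complex_def)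
qed

lemma psd_on_rank_one: "psd_on T (\<lambda>x y. a x * cnj (a y))"
  using psd_on_congruence[OF psd_on_one, of T a] by simp

lemma psd_on_scale:
  assumes "psd_on T K" "0 \<le> (t::real)"
  shows "psd_on T (\<lambda>x y. of_real t * K x y)"
proof -
  have sq: "of_real (sqrt t) * of_real (sqrt t) = (of_real t :: complex)"
    using assms(2) by (simp flip: of_real_mult)
  have *: "of_real t * z = of_real (sqrt t) * z * cnj (of_real (sqrt t))" for z :: complex
    unfolding sq[symmetric] by (simp add: mult_ac)
  show ?thesis unfolding * by (rule psd_on_congruence[OF assms(1)])
qed

lemma psd_on_diag_nonneg: "psd_on T K \<Longrightarrow> x \<in> T \<Longrightarrow> 0 \<le> K x x"
  using psd_onD[of T K "{x}" "\<lambda>_. 1"] by (simp add: qform_def)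

lemma psd_on_hermitian:
  assumes K: "psd_on T K" and xy: "x \<in> T" "y \<in> T"
  shows "K y x = cnj (K x y)"
proof (cases "x = y")
  case True
  then show ?thesis using psd_on_diag_nonneg[OF K xy(1)]
    by (auto simp: less_eq_complex_def complex_eq_iff)
next
  case False
  have "0 \<le> qform {x, y} (\<lambda>_. 1) K"
    and "0 \<le> qform {x, y} (\<lambda>z. if z = x then \<i> else 1) K"
    using psd_onD[OF K] xy by auto
  then show ?thesis using False psd_on_diag_nonneg[OF K xy(1)] psd_on_diag_nonneg[OF K xy(2)]
    by (auto simp: qform_def less_eq_complex_def complex_eq_iff)
qed

lemma qform_superset:
  assumes "finite F'" "F \<subseteq> F'" "\<And>x. x \<in> F' - F \<Longrightarrow> c x = 0"
  shows "qform F' c K = qform F c K"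
proof -
  have "(\<Sum>y\<in>F'. cnj (c x) * c y * K x y) = (\<Sum>y\<in>F. cnj (c x) * c y * K x y)" for x
    by (rule sum.mono_neutral_right) (use assms in auto)
  then have "qform F' c K = (\<Sum>x\<in>F'. \<Sum>y\<in>F. cnj (c x) * c y * K x y)"
    by (simp add: qform_def)
  also have "\<dots> = qform F c K" unfolding qform_def
    by (rule sum.mono_neutral_right) (use assms in auto)
  finally show ?thesis .
qed

text \<open>
  Points may be added to a finite set with coefficient \<open>0\<close>, so that a distinguished point can be
  assumed to be present.
\<close>

lemma psd_on_containing:
  assumes "p \<in> T" "\<And>F c. finite F \<Longrightarrow> F \<subseteq> T \<Longrightarrow> p \<in> F \<Longrightarrow> 0 \<le> qform F c K"
  shows "psd_on T K"
proof (rule psd_onI)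
  fix F c assume F: "finite F" "F \<subseteq> T"
  show "0 \<le> qform F c K"
  proof (cases "p \<in> F")
    case True
    then show ?thesis using assms(2) F by blast
  next
    case False
    have "qform F c K = qform F (c(p := 0)) K"
      by (rule qform_cong) (use False in auto)
    also have "\<dots> = qform (insert p F) (c(p := 0)) K"
      by (rule qform_superset[symmetric]) (use F in auto)
    finally show ?thesis using assms F by simp
  qed
qed

lemma qform_shift:
  assumes K: "psd_on T K" and F: "finite F" "F \<subseteq> T" and p: "p \<in> F"
  defines "a \<equiv> \<lambda>c. \<Sum>y\<in>F. c y * K p y"
  shows "qform F (\<lambda>x. c x + (if x = p then t else 0)) K
    = qform F c K + cnj t * a c + t * cnj (a c) + cnj t * t * K p p"
proof -
  have herm: "K x p = cnj (K p x)" if "x \<in> F" for x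
    using psd_on_hermitian[OF K, of p x] that F p by auto
  have ca: "(\<Sum>x\<in>F. cnj (c x) * K x p) = cnj (a c)"
    unfolding a_def cnj_sum complex_cnj_mult
    by (rule sum.cong[OF refl]) (simp add: herm)
  have "qform F (\<lambda>x. c x + (if x = p then t else 0)) K =
    (\<Sum>x\<in>F. \<Sum>y\<in>F. cnj (c x) * c y * K x y
       + (if x = p then cnj t * (c y * K p y) else 0)
       + (if y = p then t * (cnj (c x) * K x p) else 0)
       + (if x = p then if y = p then cnj t * t * K p p else 0 else 0))"
    unfolding qform_def by (intro sum.cong refl) (auto simp: algebra_simps)
  also have "\<dots> = qform F c K + (\<Sum>x\<in>F. if x = p then cnj t * a c else 0)
      + t * (\<Sum>x\<in>F. cnj (c x) * K x p)
      + (\<Sum>x\<in>F. if x = p then cnj t * t * K p p else 0)"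
  proof -
    have 1: "(\<Sum>y\<in>F. if x = p then cnj t * (c y * K p y) else 0) = (if x = p then cnj t * a c else 0)" for x
      by (simp add: a_def sum_distrib_left)
    have 2: "(\<Sum>y\<in>F. if y = p then t * (cnj (c x) * K x p) else 0) = t * (cnj (c x) * K x p)" for x
      using F p by simp
    have 3: "(\<Sum>y\<in>F. if x = p then if y = p then cnj t * t * K p p else 0 else 0)
       = (if x = p then cnj t * t * K p p else 0)" for x
      using F p by simp
    show ?thesis unfolding sum.distrib 1 2 3 qform_def sum_distrib_left ..
  qed
  finally show ?thesis using F p by (simp add: ca)
qed

text \<open>
  With a vanishing diagonal entry, a nonzero entry \<open>K x p\<close> would make the quadratic form on \<open>{x, p}\<close>
  affine and nonconstant in the second coefficient, hence negative somewhere.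
\<close>

lemma psd_on_diag_zero:
  assumes K: "psd_on T K" and xp: "x \<in> T" "p \<in> T" and 0: "K p p = 0"
  shows "K x p = 0" "K p x = 0"
proof -
  have h: "K p x = cnj (K x p)" using psd_on_hermitian[OF K] xp by blast
  have "K x p = 0"
  proof (cases "x = p")
    case False
    define m where "m = (cmod (K x p))\<^sup>2"
    define r where "r = (Re (K x x) + 1) / 2"
    have mm: "K x p * cnj (K x p) = of_real m" unfolding m_def by (rule complex_norm_square[symmetric])
    have pos: "0 \<le> Re (K x x)" "Im (K x x) = 0"
      using psd_on_diag_nonneg[OF K xp(1)] by (auto simp: less_eq_complex_def)
    have ex: "\<exists>s::real. Re (K x x) + 2 * s * m < 0" if "m > 0"
      using that by (intro exI[of _ "- (Re (K x x) + 1) / (2 * m)"]) (simp add: field_simps)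
    have "0 \<le> Re (K x x) + 2 * s * m" for s :: real
    proof -
      have "0 \<le> qform {x, p} (\<lambda>z. if z = x then 1 else of_real s * cnj (K x p)) K"
        using psd_onD[OF K] xp by auto
      also have "\<dots> = K x x + of_real s * (cnj (K x p) * K x p) + of_real s * (K x p * cnj (K x p))"
        using False by (simp add: qform_def 0 h algebra_simps)
      also have "\<dots> = K x x + of_real (2 * s * m)" using mm by (simp add: mult.commute)
      finally show ?thesis by (simp add: less_eq_complex_def)
    qed
    then have "m \<le> 0" using ex by (meson not_le)
    then show ?thesis by (simp add: m_def)
  qed (use 0 in simp)
  then show "K x p = 0" "K p x = 0" using h by auto
qed

text \<open>
  The form of the Schur complement at \<open>c\<close> is the minimum of the form of \<open>K\<close> over all changes of \<open>c\<close>
  at \<open>p\<close>; it is attained by subtracting \<open>(\<Sum>y\<in>F. c y * K p y) / K p p\<close>. If \<open>K p p = 0\<close>, the quotient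
  is \<open>0\<close> by convention and nothing is subtracted.
\<close>

lemma schur_complement:
  assumes K: "psd_on T K" and p: "p \<in> T"
  shows "psd_on T (\<lambda>x y. K x y - K x p * K p y / K p p)"
proof (cases "K p p = 0")
  case True
  then show ?thesis using K by simp
next
  case False
  show ?thesis
  proof (rule psd_on_containing[OF p])
    fix F c assume F: "finite F" "F \<subseteq> T" "p \<in> F"
    define a where "a = (\<Sum>y\<in>F. c y * K p y)"
    have herm: "K x p = cnj (K p x)" if "x \<in> F" for x
      using psd_on_hermitian[OF K, of p x] that F p by auto
    have ca: "(\<Sum>x\<in>F. cnj (c x) * K x p) = cnj a"
      unfolding a_def cnj_sum complex_cnj_mult
      by (rule sum.cong[OF refl]) (simp add: herm)
    have real: "cnj (K p p) = K p p" using psd_on_hermitian[OF K p p] by simp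
    have "qform F c (\<lambda>x y. K x y - K x p * K p y / K p p)
      = qform F c K - (\<Sum>x\<in>F. \<Sum>y\<in>F. cnj (c x) * K x p * (c y * K p y)) / K p p"
      unfolding qform_def
      by (simp add: algebra_simps sum_subtractf sum_divide_distrib)
    also have "(\<Sum>x\<in>F. \<Sum>y\<in>F. cnj (c x) * K x p * (c y * K p y)) = cnj a * a"
      by (simp only: sum_product[symmetric] ca a_def)
    also have "qform F c K - cnj a * a / K p p
      = qform F (\<lambda>x. c x + (if x = p then - a / K p p else 0)) K"
      unfolding qform_shift[OF K F(1) F(2) F(3), of c "- a / K p p"]
      using False by (simp add: a_def[symmetric] real field_simps)
    finally show "0 \<le> qform F c (\<lambda>x y. K x y - K x p * K p y / K p p)"
      using psd_onD[OF K F(1) F(2)] by simp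
  qed
qed

lemma psd_on_insert_zero:
  assumes K: "psd_on S K" and z: "\<And>x. x \<in> insert q S \<Longrightarrow> K x q = 0" "\<And>x. x \<in> insert q S \<Longrightarrow> K q x = 0"
  shows "psd_on (insert q S) K"
proof (rule psd_onI)
  fix F c assume F: "finite F" "F \<subseteq> insert q S"
  have "qform F c K = qform F (c(q := 0)) K"
    by (rule qform_cong) (use z F in \<open>auto simp: subset_iff\<close>)
  also have "\<dots> = qform (F - {q}) (c(q := 0)) K"
    by (rule qform_superset) (use F in auto)
  finally show "0 \<le> qform F c K" using psd_onD[OF K, of "F - {q}"] F by auto
qed

text \<open>
  Taking Schur complements at the points of \<open>S\<close> one after the other is the Cholesky algorithm. The
  functions \<open>b l\<close> are defined on all of \<open>T\<close>, reproduce every column of \<open>K\<close> with index in \<open>S\<close>, and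
  leave a positive remainder on \<open>T\<close>. For \<open>S = T\<close> finite this is a Gram factorization of \<open>K\<close>.
\<close>

lemma partial_factorization:
  fixes K :: "'x \<Rightarrow> 'x \<Rightarrow> complex"
  assumes K: "psd_on T K" and S: "finite S" "S \<subseteq> T"
  shows "\<exists>(r::nat) (b :: nat \<Rightarrow> 'x \<Rightarrow> complex). psd_on T (\<lambda>x y. K x y - (\<Sum>l<r. b l x * cnj (b l y)))
    \<and> (\<forall>x\<in>T. \<forall>y\<in>S. K x y = (\<Sum>l<r. b l x * cnj (b l y)))"
  using S
proof (induction S rule: finite_induct)
  case empty
  show ?case using K by (intro exI[of _ 0]) auto
next
  case (insert p S)
  then obtain r :: nat and b :: "nat \<Rightarrow> 'x \<Rightarrow> complex"
    where psd: "psd_on T (\<lambda>x y. K x y - (\<Sum>l<r. b l x * cnj (b l y)))"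
    and eq: "\<And>x y. x \<in> T \<Longrightarrow> y \<in> S \<Longrightarrow> K x y = (\<Sum>l<r. b l x * cnj (b l y))" by auto
  define L where "L = (\<lambda>x y. K x y - (\<Sum>l<r. b l x * cnj (b l y)))"
  have L: "psd_on T L" using psd by (simp add: L_def)
  have p: "p \<in> T" using insert by auto
  define d where "d = sqrt (Re (L p p))"
  have Lpp: "L p p = of_real d * of_real d"
    using psd_on_diag_nonneg[OF L p]
    by (auto simp: d_def less_eq_complex_def complex_eq_iff simp flip: of_real_mult)
  define b' where "b' = b(r := (\<lambda>x. L x p / of_real d))"
  have new: "(\<Sum>l<Suc r. b' l x * cnj (b' l y)) = (\<Sum>l<r. b l x * cnj (b l y)) + L x p * L p y / L p p"
    if "x \<in> T" "y \<in> T" for x y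
  proof -
    have "(\<Sum>l<r. b' l x * cnj (b' l y)) = (\<Sum>l<r. b l x * cnj (b l y))"
      by (rule sum.cong) (auto simp: b'_def)
    moreover have "b' r x * cnj (b' r y) = L x p * L p y / L p p"
      using psd_on_hermitian[OF L that(2) p] by (simp add: b'_def Lpp)
    ultimately show ?thesis by simp
  qed
  have "psd_on T (\<lambda>x y. L x y - L x p * L p y / L p p)"
    by (rule schur_complement[OF L p])
  then have 1: "psd_on T (\<lambda>x y. K x y - (\<Sum>l<Suc r. b' l x * cnj (b' l y)))"
    by (rule psd_on_cong) (auto simp only: new L_def diff_diff_eq)
  have 2: "K x y = (\<Sum>l<Suc r. b' l x * cnj (b' l y))" if "x \<in> T" "y \<in> insert p S" for x y
  proof -
    have y: "y \<in> T" using that insert by auto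
    have Lxy: "L x y = L x p * L p y / L p p"
    proof (cases "y = p")
      case True
      then show ?thesis using psd_on_diag_zero(1)[OF L that(1) p] by auto
    next
      case False
      then have "y \<in> S" using that by auto
      then have "L z y = 0" if "z \<in> T" for z using eq[OF that] by (simp add: L_def)
      then show ?thesis using that p by simp
    qed
    have "K x y = (\<Sum>l<r. b l x * cnj (b l y)) + L x y"
      by (simp add: L_def)
    then have "K x y = (\<Sum>l<r. b l x * cnj (b l y)) + L x p * L p y / L p p"
      by (simp only: Lxy)
    then show ?thesis by (simp only: new[OF that(1) y])
  qed
  show ?case using 1 2 by blast
qed

text \<open>
  By a Gram factorization of \<open>M\<close>, the product is a sum of congruences of \<open>K\<close>.
\<close>

lemma schur_product:
  assumes K: "psd_on T K" and M: "psd_on T M"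
  shows "psd_on T (\<lambda>x y. K x y * M x y)"
proof (rule psd_on_finite_subsets)
  fix F assume F: "finite F" "F \<subseteq> T"
  obtain r b where b: "\<And>x y. x \<in> F \<Longrightarrow> y \<in> F \<Longrightarrow> M x y = (\<Sum>l<(r::nat). b l x * cnj (b l y))"
    using partial_factorization[OF psd_on_mono[OF M F(2)] F(1) order_refl] by blast
  have "psd_on F (\<lambda>x y. \<Sum>l<r. b l x * K x y * cnj (b l y))"
    by (intro psd_on_sum psd_on_congruence psd_on_mono[OF K F(2)])
  then show "psd_on F (\<lambda>x y. K x y * M x y)"
    by (rule psd_on_cong) (auto simp: b sum_distrib_left mult_ac)
qed

section \<open>Geometry of a reproducing kernel Hilbert space\<close>

context rkhs
begin

lemma sum_mem: "(\<And>i. i \<in> I \<Longrightarrow> f i \<in> H) \<Longrightarrow> (\<lambda>x. \<Sum>i\<in>I. f i x) \<in> H"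
  by (induction I rule: infinite_finite_induct) (auto intro: zero_mem add_mem)

lemma diff_mem: "f \<in> H \<Longrightarrow> g \<in> H \<Longrightarrow> (\<lambda>x. f x - g x) \<in> H"
  using add_mem[OF _ scale_mem[of g "-1"], of f] by simp

lemma ip_zero_left: "h \<in> H \<Longrightarrow> ip (\<lambda>x. 0) h = 0"
  using ip_scale[OF zero_mem, of h 0] by simp

lemma ip_sum_left:
  "(\<And>i. i \<in> I \<Longrightarrow> f i \<in> H) \<Longrightarrow> h \<in> H \<Longrightarrow> ip (\<lambda>x. \<Sum>i\<in>I. f i x) h = (\<Sum>i\<in>I. ip (f i) h)"
  by (induction I rule: infinite_finite_induct) (auto simp: ip_zero_left ip_add sum_mem)

lemma ip_scale_right: "f \<in> H \<Longrightarrow> h \<in> H \<Longrightarrow> ip f (\<lambda>x. c * h x) = cnj c * ip f h"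
  using ip_commute[OF scale_mem, of h f c] ip_commute[of h f] by (simp add: ip_scale)

lemma ip_add_right: "f \<in> H \<Longrightarrow> g \<in> H \<Longrightarrow> h \<in> H \<Longrightarrow> ip f (\<lambda>x. g x + h x) = ip f g + ip f h"
  using ip_commute[OF add_mem, of g h f] ip_commute[of g f] ip_commute[of h f] by (simp add: ip_add)

lemma ip_sum_right:
  "(\<And>i. i \<in> I \<Longrightarrow> f i \<in> H) \<Longrightarrow> h \<in> H \<Longrightarrow> ip h (\<lambda>x. \<Sum>i\<in>I. f i x) = (\<Sum>i\<in>I. ip h (f i))"
  using ip_commute[OF sum_mem, of I f h] ip_sum_left[of I f h] ip_commute[of _ h]
  by (simp add: cnj_sum)

lemma ip_diff_left: "f \<in> H \<Longrightarrow> g \<in> H \<Longrightarrow> h \<in> H \<Longrightarrow> ip (\<lambda>x. f x - g x) h = ip f h - ip g h"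
  using ip_add[OF _ scale_mem[of g "-1"], of f h] ip_scale[of g h "-1"] by simp

lemma ip_diff_right: "f \<in> H \<Longrightarrow> g \<in> H \<Longrightarrow> h \<in> H \<Longrightarrow> ip f (\<lambda>x. g x - h x) = ip f g - ip f h"
  using ip_add_right[OF _ _ scale_mem[of h "-1"], of f g] ip_scale_right[of f h "-1"] by simp

lemma ip_self: "f \<in> H \<Longrightarrow> ip f f = of_real ((hnorm ip f)\<^sup>2)"
  using ip_commute[of f f] ip_nonneg[of f] by (simp add: hnorm_def complex_eq_iff)

lemma hnorm_nonneg: "f \<in> H \<Longrightarrow> 0 \<le> hnorm ip f"
  by (simp add: hnorm_def ip_nonneg)

lemma hnorm_sq: "f \<in> H \<Longrightarrow> (hnorm ip f)\<^sup>2 = Re (ip f f)"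
  by (simp add: hnorm_def ip_nonneg)

lemma hnorm_zero [simp]: "hnorm ip (\<lambda>x. 0) = 0"
  by (simp add: hnorm_def ip_zero_left zero_mem)

lemma hnorm_sq_scale: "f \<in> H \<Longrightarrow> (hnorm ip (\<lambda>x. c * f x))\<^sup>2 = (cmod c)\<^sup>2 * (hnorm ip f)\<^sup>2"
proof -
  assume f: "f \<in> H"
  have "ip (\<lambda>x. c * f x) (\<lambda>x. c * f x) = (c * cnj c) * ip f f"
    using f by (simp add: ip_scale ip_scale_right scale_mem)
  then have "complex_of_real ((hnorm ip (\<lambda>x. c * f x))\<^sup>2) = of_real ((cmod c)\<^sup>2 * (hnorm ip f)\<^sup>2)"
    using f ip_self[of f] ip_self[OF scale_mem[OF f], of c]
    by (simp add: complex_norm_square[symmetric])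
  then show ?thesis by (simp only: of_real_eq_iff)
qed

lemma hnorm_sq_add:
  assumes "f \<in> H" "g \<in> H"
  shows "(hnorm ip (\<lambda>x. f x + g x))\<^sup>2 = (hnorm ip f)\<^sup>2 + 2 * Re (ip f g) + (hnorm ip g)\<^sup>2"
  using assms ip_commute[of f g] by (simp add: hnorm_sq add_mem ip_add ip_add_right)

lemma hnorm_sq_diff:
  assumes "f \<in> H" "g \<in> H"
  shows "(hnorm ip (\<lambda>x. f x - g x))\<^sup>2 = (hnorm ip f)\<^sup>2 - 2 * Re (ip f g) + (hnorm ip g)\<^sup>2"
  using assms ip_commute[of f g] by (simp add: hnorm_sq diff_mem ip_diff_left ip_diff_right)

lemma cauchy_schwarz:
  assumes "f \<in> H" "g \<in> H"
  shows "cmod (ip f g) \<le> hnorm ip f * hnorm ip g"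
proof (cases "g = (\<lambda>x. 0)")
  case True
  then have "ip f g = 0" using ip_commute[OF assms] ip_zero_left[OF assms(1)] by simp
  then show ?thesis using assms by (simp add: hnorm_nonneg)
next
  case False
  then have n: "(hnorm ip g)\<^sup>2 > 0"
    using ip_definite[OF assms(2)] ip_self[OF assms(2)] by (auto simp: zero_less_power2)
  define c where "c = ip f g / of_real ((hnorm ip g)\<^sup>2)"
  have "0 \<le> (hnorm ip (\<lambda>x. f x - c * g x))\<^sup>2" by simp
  also have "\<dots> = (hnorm ip f)\<^sup>2 - 2 * Re (cnj c * ip f g) + (cmod c)\<^sup>2 * (hnorm ip g)\<^sup>2"
    using assms by (simp add: hnorm_sq_diff scale_mem ip_scale_right hnorm_sq_scale)
  also have "cnj c * ip f g = of_real ((cmod (ip f g))\<^sup>2 / (hnorm ip g)\<^sup>2)"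
  proof -
    have "cnj c * ip f g = (ip f g * cnj (ip f g)) / of_real ((hnorm ip g)\<^sup>2)"
      by (simp add: c_def)
    then show ?thesis by (simp only: complex_norm_square of_real_divide)
  qed
  also have "(cmod c)\<^sup>2 * (hnorm ip g)\<^sup>2 = (cmod (ip f g))\<^sup>2 / (hnorm ip g)\<^sup>2"
  proof -
    have gen: "(a / N)\<^sup>2 * N = a\<^sup>2 / N" if "N > 0" for a N :: real
      using that by (simp add: power2_eq_square)
    have "cmod c = cmod (ip f g) / (hnorm ip g)\<^sup>2"
      unfolding c_def norm_divide norm_of_real by simp
    then show ?thesis by (simp only: gen[OF n])
  qed
  finally have "(cmod (ip f g))\<^sup>2 / (hnorm ip g)\<^sup>2 \<le> (hnorm ip f)\<^sup>2"
    by (simp only: Re_complex_of_real)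
  then have "(cmod (ip f g))\<^sup>2 \<le> (hnorm ip f * hnorm ip g)\<^sup>2"
    using n by (simp add: field_simps power_mult_distrib)
  then show ?thesis using assms by (simp add: power2_le_iff_abs_le hnorm_nonneg)
qed

lemma hnorm_triangle:
  assumes "f \<in> H" "g \<in> H"
  shows "hnorm ip (\<lambda>x. f x + g x) \<le> hnorm ip f + hnorm ip g"
proof -
  have "Re (ip f g) \<le> hnorm ip f * hnorm ip g"
    using cauchy_schwarz[OF assms] complex_Re_le_cmod[of "ip f g"] by linarith
  then have "(hnorm ip (\<lambda>x. f x + g x))\<^sup>2 \<le> (hnorm ip f + hnorm ip g)\<^sup>2"
    using hnorm_sq_add[OF assms] by (simp add: power2_sum)
  then show ?thesis using assms hnorm_nonneg by (simp add: power2_le_iff_abs_le add_nonneg_nonneg)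
qed

lemma evaluation_bound: "f \<in> H \<Longrightarrow> cmod (f x) \<le> hnorm ip f * hnorm ip (\<lambda>z. k z x)"
  using reproducing[of f x] cauchy_schwarz[OF _ kernel_mem, of f x] by simp

lemma qform_gram:
  assumes E: "\<And>x. x \<in> F \<Longrightarrow> E x \<in> H"
  shows "qform F c (\<lambda>x y. ip (E y) (E x)) = of_real ((hnorm ip (\<lambda>z. \<Sum>x\<in>F. c x * E x z))\<^sup>2)"
proof -
  have mem: "(\<lambda>z. c x * E x z) \<in> H" if "x \<in> F" for x using E[OF that] by (rule scale_mem)
  have "ip (\<lambda>z. \<Sum>y\<in>F. c y * E y z) (\<lambda>z. \<Sum>x\<in>F. c x * E x z)
    = (\<Sum>x\<in>F. ip (\<lambda>z. \<Sum>y\<in>F. c y * E y z) (\<lambda>z. c x * E x z))"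
    by (rule ip_sum_right) (auto intro: mem sum_mem)
  also have "\<dots> = (\<Sum>x\<in>F. \<Sum>y\<in>F. ip (\<lambda>z. c y * E y z) (\<lambda>z. c x * E x z))"
    by (intro sum.cong[OF refl] ip_sum_left) (auto intro: mem)
  also have "\<dots> = qform F c (\<lambda>x y. ip (E y) (E x))"
    unfolding qform_def
    by (intro sum.cong[OF refl]) (simp add: ip_scale ip_scale_right scale_mem E mult_ac)
  finally show ?thesis
    using ip_self[OF sum_mem, of F "\<lambda>y z. c y * E y z"] mem by simp
qed

lemma gram_psd:
  assumes "\<And>x. x \<in> T \<Longrightarrow> E x \<in> H"
  shows "psd_on T (\<lambda>x y. ip (E y) (E x))"
proof (rule psd_onI)
  fix F c assume F: "finite F" "F \<subseteq> T"
  have "E x \<in> H" if "x \<in> F" for x using assms F that by auto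
  then show "0 \<le> qform F c (\<lambda>x y. ip (E y) (E x))"
    by (simp add: qform_gram less_eq_complex_def)
qed

lemma kernel_gram: "k x y = ip (\<lambda>z. k z y) (\<lambda>z. k z x)"
  by (rule reproducing[OF kernel_mem])

lemma kernel_psd: "psd_on T k"
  using gram_psd[of T "\<lambda>x z. k z x"] kernel_mem by (simp flip: kernel_gram)

text \<open>
  The functions of \<open>H\<close> that agree with \<open>u\<close> on a finite set \<open>F\<close> form a convex set \<open>A F\<close>, which shrinks
  as \<open>F\<close> grows. Let \<open>D\<close> be the supremum over \<open>F\<close> of the least squared norm in \<open>A F\<close>. By the
  parallelogram law, two elements of \<open>A F\<close> with squared norm close to \<open>D\<close> are close to each other
  as soon as \<open>F\<close> nearly attains the supremum. So nearly minimal elements along a suitable sequence of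
  finite sets converge, and the limit does not change when one more point is added to all sets of the
  sequence; it therefore agrees with \<open>u\<close> at every point.
\<close>

lemma mem_if_finitely_interpolated:
  assumes C: "\<And>F. finite F \<Longrightarrow> \<exists>h\<in>H. (\<forall>x\<in>F. h x = u x) \<and> (hnorm ip h)\<^sup>2 \<le> C"
  shows "u \<in> H \<and> (hnorm ip u)\<^sup>2 \<le> C"
proof -
  define A where "A = (\<lambda>F. {h \<in> H. \<forall>x\<in>F. h x = u x})"
  define d where "d = (\<lambda>F. Inf ((\<lambda>h. (hnorm ip h)\<^sup>2) ` A F))"
  have bdd: "bdd_below ((\<lambda>h. (hnorm ip h)\<^sup>2) ` A F)" for F
    by (rule bdd_belowI[of _ 0]) auto
  have AH: "h \<in> A F \<Longrightarrow> h \<in> H" for h F by (simp add: A_def)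
  have d_le: "d F \<le> (hnorm ip h)\<^sup>2" if "h \<in> A F" for h F
    unfolding d_def by (rule cInf_lower[OF _ bdd]) (use that in auto)
  have d_C: "d F \<le> C" if "finite F" for F
    using C[OF that] d_le[of _ F] unfolding A_def by fastforce
  have ne: "A F \<noteq> {}" if "finite F" for F using C[OF that] by (auto simp: A_def)
  define D where "D = Sup (d ` {F. finite F})"
  have bddD: "bdd_above (d ` {F. finite F})" by (rule bdd_aboveI[of _ C]) (use d_C in auto)
  have d_D: "d F \<le> D" if "finite F" for F
    unfolding D_def by (rule cSup_upper[OF _ bddD]) (use that in auto)
  have D_C: "D \<le> C"
    unfolding D_def by (rule cSup_least) (use d_C in auto)
  have "\<exists>F. finite F \<and> D - e < d F" if "e > 0" for e
  proof -
    have "D - e < Sup (d ` {F. finite F})" using that by (simp add: D_def)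
    then show ?thesis using less_cSupD[of "d ` {F. finite F}" "D - e"] by blast
  qed
  then have "\<exists>F. finite F \<and> D - 1 / Suc n < d F" for n by simp
  then obtain P where P: "\<And>n. finite (P n)" "\<And>n. D - 1 / Suc n < d (P n)" by metis
  define G where "G = (\<lambda>n. \<Union>m\<le>n. P m)"
  have G: "finite (G n)" "m \<le> n \<Longrightarrow> P m \<subseteq> G n" for m n using P by (auto simp: G_def)
  have near: "\<exists>h\<in>A F. (hnorm ip h)\<^sup>2 < D + e" if "finite F" "e > 0" for F e
  proof -
    have "Inf ((\<lambda>h. (hnorm ip h)\<^sup>2) ` A F) < D + e"
      using d_D[OF that(1)] that(2) by (simp add: d_def)
    then show ?thesis using cInf_lessD[of "(\<lambda>h. (hnorm ip h)\<^sup>2) ` A F" "D + e"] ne[OF that(1)] by blast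
  qed
  have close: "(hnorm ip (\<lambda>x. g x - h x))\<^sup>2 < 8 / Suc N"
    if "g \<in> A (P N)" "h \<in> A (P N)" "(hnorm ip g)\<^sup>2 < D + 1 / Suc N" "(hnorm ip h)\<^sup>2 < D + 1 / Suc N"
    for g h N
  proof -
    have gh: "g \<in> H" "h \<in> H" using that AH by auto
    define e where "e = 1 / real (Suc N)"
    have Pe: "D - e < d (P N)" using P(2)[of N] by (simp only: e_def)
    have ge: "(hnorm ip g)\<^sup>2 < D + e" and he: "(hnorm ip h)\<^sup>2 < D + e"
      using that(3,4) by (simp_all only: e_def)
    \<comment> \<open>the midpoint lies in \<open>A (P N)\<close>, so its squared norm is at least \<open>D - e\<close>\<close>
    define m where "m = (\<lambda>x. (1/2) * (g x + h x))"
    have "m \<in> H" unfolding m_def by (intro scale_mem add_mem gh)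
    moreover have "\<forall>x\<in>P N. m x = u x" using that(1,2) by (simp add: m_def A_def)
    ultimately have "m \<in> A (P N)" by (simp add: A_def)
    then have "d (P N) \<le> (hnorm ip m)\<^sup>2" by (rule d_le)
    moreover have "4 * (hnorm ip m)\<^sup>2 = (hnorm ip (\<lambda>x. g x + h x))\<^sup>2"
      unfolding m_def hnorm_sq_scale[OF add_mem[OF gh]] by (simp add: norm_divide power_divide)
    ultimately have "4 * D - 4 * e < (hnorm ip (\<lambda>x. g x + h x))\<^sup>2" using Pe by linarith
    moreover have "(hnorm ip (\<lambda>x. g x - h x))\<^sup>2 + (hnorm ip (\<lambda>x. g x + h x))\<^sup>2
        = 2 * (hnorm ip g)\<^sup>2 + 2 * (hnorm ip h)\<^sup>2"
      unfolding hnorm_sq_add[OF gh] hnorm_sq_diff[OF gh] by simp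
    moreover have "8 / real (Suc N) = 8 * e" by (simp add: e_def)
    ultimately show ?thesis using ge he by linarith
  qed
  have "\<exists>h\<in>A (G n). (hnorm ip h)\<^sup>2 < D + 1 / Suc n" for n by (rule near) (auto simp: G)
  then obtain g where g: "\<And>n. g n \<in> A (G n)" "\<And>n. (hnorm ip (g n))\<^sup>2 < D + 1 / Suc n" by metis
  have gH: "g n \<in> H" for n using g(1) AH by blast
  have gP: "g n \<in> A (P m)" if "m \<le> n" for m n using g(1)[of n] G(2)[OF that] by (auto simp: A_def)
  have mono: "D + 1 / Suc n \<le> D + 1 / Suc N" if "N \<le> n" for n N
    using that by (simp add: frac_le)
  have small: "\<exists>N. 8 / real (Suc N) < e\<^sup>2" if "e > 0" for e :: real
  proof -
    have "0 < e\<^sup>2 / 8" using that by simp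
    then obtain N where "inverse (real (Suc N)) < e\<^sup>2 / 8" using reals_Archimedean by blast
    then have "8 * inverse (real (Suc N)) < e\<^sup>2" by linarith
    then have "8 / real (Suc N) < e\<^sup>2" by (simp only: divide_inverse)
    then show ?thesis by blast
  qed
  have "\<exists>f\<in>H. (\<lambda>n. hnorm ip (\<lambda>x. g n x - f x)) \<longlonglongrightarrow> 0"
  proof (rule complete[OF gH], intro allI impI)
    fix e :: real assume "e > 0"
    then obtain N where N: "8 / real (Suc N) < e\<^sup>2" using small by blast
    have "hnorm ip (\<lambda>x. g m x - g n x) < e" if "m \<ge> N" "n \<ge> N" for m n
    proof -
      have "(hnorm ip (\<lambda>x. g m x - g n x))\<^sup>2 < e\<^sup>2"
        using close[OF gP[OF that(1)] gP[OF that(2)]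
          less_le_trans[OF g(2) mono[OF that(1)]] less_le_trans[OF g(2) mono[OF that(2)]]] N
        by (rule less_trans)
      then show ?thesis using \<open>e > 0\<close> by (meson less_eq_real_def power_less_imp_less_base)
    qed
    then show "\<exists>N. \<forall>m\<ge>N. \<forall>n\<ge>N. hnorm ip (\<lambda>x. g m x - g n x) < e" by blast
  qed
  then obtain f where f: "f \<in> H" and lim: "(\<lambda>n. hnorm ip (\<lambda>x. g n x - f x)) \<longlonglongrightarrow> 0" by blast
  have inv0: "(\<lambda>n. 8 / real (Suc n)) \<longlonglongrightarrow> 0"
    using tendsto_mult[OF tendsto_const[of 8] LIMSEQ_inverse_real_of_nat] by (simp add: divide_inverse)
  have "f x = u x" for x
  proof -
    \<comment> \<open>adding \<open>x\<close> to each set of the sequence gives nearly minimal elements that are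
      exact at \<open>x\<close> and still close to \<open>g n\<close>\<close>
    have "\<exists>h\<in>A (insert x (G n)). (hnorm ip h)\<^sup>2 < D + 1 / Suc n" for n by (rule near) (auto simp: G)
    then obtain h where h: "\<And>n. h n \<in> A (insert x (G n))" "\<And>n. (hnorm ip (h n))\<^sup>2 < D + 1 / Suc n"
      by metis
    have hH: "h n \<in> H" for n using h(1) AH by blast
    have hx: "h n x = u x" for n using h(1)[of n] by (simp add: A_def)
    have hP: "h n \<in> A (P n)" for n using h(1)[of n] G(2)[of n n] by (auto simp: A_def)
    define \<kappa> where "\<kappa> = hnorm ip (\<lambda>z. k z x)"
    have \<kappa>: "0 \<le> \<kappa>" unfolding \<kappa>_def by (rule hnorm_nonneg[OF kernel_mem])
    have "cmod (f x - u x) \<le> hnorm ip (\<lambda>z. g n z - f z) * \<kappa> + sqrt (8 / real (Suc n)) * \<kappa>" for n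
    proof -
      have "cmod (g n x - f x) \<le> hnorm ip (\<lambda>z. g n z - f z) * \<kappa>"
        unfolding \<kappa>_def by (rule evaluation_bound[OF diff_mem[OF gH f]])
      moreover have "cmod (g n x - h n x) \<le> hnorm ip (\<lambda>z. g n z - h n z) * \<kappa>"
        unfolding \<kappa>_def by (rule evaluation_bound[OF diff_mem[OF gH hH]])
      moreover have "hnorm ip (\<lambda>z. g n z - h n z) \<le> sqrt (8 / real (Suc n))"
        using close[OF gP[OF order_refl] hP g(2) h(2), of n] by (intro real_le_rsqrt) simp
      then have "hnorm ip (\<lambda>z. g n z - h n z) * \<kappa> \<le> sqrt (8 / real (Suc n)) * \<kappa>"
        by (rule mult_right_mono[OF _ \<kappa>])
      moreover have "cmod (f x - u x) \<le> cmod (g n x - f x) + cmod (g n x - h n x)"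
        using norm_triangle_ineq4[of "g n x - h n x" "g n x - f x"] by (simp add: hx)
      ultimately show ?thesis by linarith
    qed
    moreover have "(\<lambda>n. hnorm ip (\<lambda>z. g n z - f z) * \<kappa> + sqrt (8 / real (Suc n)) * \<kappa>) \<longlonglongrightarrow> 0 * \<kappa> + sqrt 0 * \<kappa>"
      by (intro tendsto_intros lim inv0)
    ultimately have "cmod (f x - u x) \<le> 0 * \<kappa> + sqrt 0 * \<kappa>"
      by (intro LIMSEQ_le_const) auto
    then show ?thesis by simp
  qed
  then have fu: "f = u" by blast
  have "hnorm ip f \<le> sqrt (D + 1 / Suc n) + hnorm ip (\<lambda>z. g n z - f z)" for n
  proof -
    have "hnorm ip (\<lambda>z. (-1) * (g n z - f z)) = hnorm ip (\<lambda>z. g n z - f z)"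
      using hnorm_sq_scale[OF diff_mem[OF gH f], of "-1" n] hnorm_nonneg[OF diff_mem[OF gH f], of n]
        hnorm_nonneg[OF scale_mem[OF diff_mem[OF gH f]], of "-1" n] by (simp add: power2_eq_iff_nonneg)
    moreover have "hnorm ip (\<lambda>z. g n z + (-1) * (g n z - f z))
        \<le> hnorm ip (g n) + hnorm ip (\<lambda>z. (-1) * (g n z - f z))"
      by (rule hnorm_triangle[OF gH scale_mem[OF diff_mem[OF gH f]]])
    moreover have "hnorm ip (g n) \<le> sqrt (D + 1 / Suc n)"
      using g(2)[of n] by (intro real_le_rsqrt) simp
    ultimately show ?thesis by simp
  qed
  moreover have "(\<lambda>n. sqrt (D + 1 / Suc n) + hnorm ip (\<lambda>z. g n z - f z)) \<longlonglongrightarrow> sqrt (D + 0) + 0"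
    using LIMSEQ_inverse_real_of_nat by (intro tendsto_intros lim) (simp add: divide_inverse)
  ultimately have "hnorm ip f \<le> sqrt (D + 0) + 0" by (intro LIMSEQ_le_const) auto
  then have "hnorm ip f \<le> sqrt D" by simp
  moreover have "D \<ge> 0"
    using d_D[of "{}"] cInf_greatest[of "(\<lambda>h. (hnorm ip h)\<^sup>2) ` A {}" 0] ne[of "{}"]
    by (fastforce simp: d_def)
  ultimately have "(hnorm ip f)\<^sup>2 \<le> D"
    using hnorm_nonneg[OF f] by (metis power_mono real_sqrt_pow2)
  then show ?thesis using D_C f fu by auto
qed

end

section \<open>Pick interpolation by rows of multipliers\<close>

lemma psd_on_family:
  assumes K: "psd_on T K" and I: "finite I" and z: "inj_on z I" "z ` I \<subseteq> T"
  shows "0 \<le> (\<Sum>i\<in>I. \<Sum>j\<in>I. cnj (v i) * v j * K (z i) (z j))"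
proof -
  have "qform (z ` I) (\<lambda>x. v (inv_into I z x)) K = (\<Sum>i\<in>I. \<Sum>j\<in>I. cnj (v i) * v j * K (z i) (z j))"
    unfolding qform_def sum.reindex[OF z(1)] using z(1) by (simp cong: sum.cong)
  moreover have "0 \<le> qform (z ` I) (\<lambda>x. v (inv_into I z x)) K"
    by (rule psd_onD[OF K]) (use I z in auto)
  ultimately show ?thesis by (simp only:)
qed

lemma mat_adjoint_index:
  fixes A :: "complex mat"
  assumes "i < dim_col A" "j < dim_row A"
  shows "mat_adjoint A $$ (i, j) = cnj (A $$ (j, i))"
  using assms by (simp add: mat_adjoint_def mat_of_rows_index)

text \<open>
  Rows are padded with zeros to square matrices, the format of the Pick problem.
\<close>

definition row_matrix :: "nat \<Rightarrow> (nat \<Rightarrow> complex) \<Rightarrow> complex mat"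
  where "row_matrix r w = mat r r (\<lambda>(s, t). if s = 0 then w t else 0)"

lemma row_matrix_carrier: "row_matrix r w \<in> carrier_mat r r"
  by (simp add: row_matrix_def)

text \<open>
  \<open>I - V W*\<close> is diagonal for such matrices, so that the Pick matrix below splits into one block with
  the row kernel and \<open>r - 1\<close> blocks with \<open>k\<close> itself.
\<close>

lemma row_matrix_defect:
  assumes "s < r" "t < r"
  shows "(1\<^sub>m r - row_matrix r v * mat_adjoint (row_matrix r w)) $$ (s, t)
    = (if s = t then 1 - (if s = 0 then \<Sum>l<r. v l * cnj (w l) else 0) else 0)"
proof -
  have dims: "dim_row (mat_adjoint (row_matrix r w)) = r" "dim_col (mat_adjoint (row_matrix r w)) = r"
    by (simp_all add: mat_adjoint_def row_matrix_def)
  have "(row_matrix r v * mat_adjoint (row_matrix r w)) $$ (s, t)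
      = (\<Sum>l<r. row_matrix r v $$ (s, l) * mat_adjoint (row_matrix r w) $$ (l, t))"
    using assms dims by (simp add: scalar_prod_def row_matrix_def atLeast0LessThan)
  also have "\<dots> = (\<Sum>l<r. (if s = 0 then v l else 0) * (if t = 0 then cnj (w l) else 0))"
    by (rule sum.cong) (use assms in \<open>auto simp: mat_adjoint_index row_matrix_def\<close>)
  also have "\<dots> = (if s = 0 \<and> t = 0 then \<Sum>l<r. v l * cnj (w l) else 0)" by auto
  finally show ?thesis using assms dims by (simp add: row_matrix_def)
qed

lemma sum_blocks: "(\<Sum>a<n * r. g a) = (\<Sum>i<n. \<Sum>s<r. g (i * r + s))" for n r :: nat
proof -
  have "(\<Sum>a<n * r. g a) = (\<Sum>i<n. sum g {i * r..<i * r + r})" by (rule sum.nat_group[symmetric])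
  moreover have "sum g {i * r..<i * r + r} = (\<Sum>s<r. g (i * r + s))" for i
    using sum.shift_bounds_nat_ivl[of g 0 "i * r" r] by (simp add: atLeast0LessThan add.commute)
  ultimately show ?thesis by simp
qed

lemma pick_mat_row_psd:
  assumes k: "psd_on S k" and w: "psd_on S (\<lambda>x y. k x y * (1 - (\<Sum>l<r. w l x * cnj (w l y))))"
    and z: "inj_on z {..<n}" "z ` {..<n} \<subseteq> S"
  shows "psd_mat (pick_mat k r n z (\<lambda>i. row_matrix r (\<lambda>l. w l (z i))))" (is "psd_mat ?A")
  unfolding psd_mat_def
proof (intro conjI ballI)
  show "square_mat ?A" by (simp add: pick_mat_def)
  fix v :: "complex vec" assume "v \<in> carrier_vec (dim_row ?A)"
  then have v: "dim_vec v = n * r" by (simp add: pick_mat_def)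
  have dims: "dim_row ?A = n * r" "dim_col ?A = n * r" by (simp_all add: pick_mat_def)
  have lt: "i * r + s < n * r" if "i < n" "s < r" for i s
  proof -
    have "Suc i * r \<le> n * r" using that by (intro mult_le_mono1) simp
    then show ?thesis using that by simp
  qed
  define q where "q = (\<lambda>s x y. k x y * (1 - (if s = (0::nat) then \<Sum>l<r. w l x * cnj (w l y) else 0)))"
  have entry: "?A $$ (i * r + s, j * r + t) = (if s = t then q s (z i) (z j) else 0)"
    if "i < n" "j < n" "s < r" "t < r" for i j s t
    using that lt[of i s] lt[of j t] by (auto simp: pick_mat_def row_matrix_defect q_def)
  have "(?A *\<^sub>v v) \<bullet>c v = (\<Sum>a<n * r. \<Sum>b<n * r. ?A $$ (a, b) * v $ b * cnj (v $ a))"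
    using v dims by (simp add: scalar_prod_def atLeast0LessThan sum_distrib_right)
  also have "\<dots> = (\<Sum>i<n. \<Sum>s<r. \<Sum>j<n. \<Sum>t<r.
      ?A $$ (i * r + s, j * r + t) * v $ (j * r + t) * cnj (v $ (i * r + s)))"
    by (simp only: sum_blocks)
  also have "\<dots> = (\<Sum>i<n. \<Sum>s<r. \<Sum>j<n. \<Sum>t<r.
      if t = s then cnj (v $ (i * r + s)) * v $ (j * r + s) * q s (z i) (z j) else 0)"
    by (intro sum.cong refl) (auto simp: entry)
  also have "\<dots> = (\<Sum>i<n. \<Sum>s<r. \<Sum>j<n. cnj (v $ (i * r + s)) * v $ (j * r + s) * q s (z i) (z j))"
    by (intro sum.cong refl) simp
  also have "\<dots> = (\<Sum>s<r. \<Sum>i<n. \<Sum>j<n. cnj (v $ (i * r + s)) * v $ (j * r + s) * q s (z i) (z j))"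
    by (rule sum.swap)
  also have "0 \<le> \<dots>"
  proof (rule sum_nonneg)
    fix s
    have "psd_on S (q s)" using k w by (cases "s = 0") (simp_all add: q_def)
    then show "0 \<le> (\<Sum>i<n. \<Sum>j<n. cnj (v $ (i * r + s)) * v $ (j * r + s) * q s (z i) (z j))"
      by (rule psd_on_family) (use z in auto)
  qed
  finally show "0 \<le> (?A *\<^sub>v v) \<bullet>c v" .
qed

locale complete_pick_space = rkhs H ip k
  for H :: "('x \<Rightarrow> complex) set" and ip k +
  assumes diag: "k x x \<noteq> 0"
    and pick: "complete_pick H ip k"
begin

text \<open>
  The row acts from \<open>r\<close>-tuples of elements of \<open>H\<close> to \<open>H\<close>. Only the sum is required to lie in \<open>H\<close>, but
  applied to tuples with one nonzero entry this makes every entry a multiplier.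
\<close>

definition contractive_row :: "nat \<Rightarrow> (nat \<Rightarrow> 'x \<Rightarrow> complex) \<Rightarrow> bool"
  where "contractive_row r b \<longleftrightarrow> (\<forall>g. (\<forall>l<r. g l \<in> H) \<longrightarrow>
    (\<lambda>x. \<Sum>l<r. b l x * g l x) \<in> H \<and>
    (hnorm ip (\<lambda>x. \<Sum>l<r. b l x * g l x))\<^sup>2 \<le> (\<Sum>l<r. (hnorm ip (g l))\<^sup>2))"

text \<open>
  The first row of a contractive matrix of multipliers is a contractive row.
\<close>

lemma row_interpolation:
  assumes S: "finite S" and w: "psd_on S (\<lambda>x y. k x y * (1 - (\<Sum>l<r. w l x * cnj (w l y))))"
  shows "\<exists>b. contractive_row r b \<and> (\<forall>l<r. \<forall>x\<in>S. b l x = w l x)"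
proof (cases "r = 0")
  case True
  then show ?thesis by (auto simp: contractive_row_def zero_mem)
next
  case False
  then have r: "0 < r" by simp
  define n where "n = card S"
  obtain z where "bij_betw z {0..<n} S" using ex_bij_betw_nat_finite[OF S] by (auto simp: n_def)
  then have z: "inj_on z {..<n}" "z ` {..<n} = S"
    by (auto simp: bij_betw_def atLeast0LessThan)
  define W where "W = (\<lambda>i. row_matrix r (\<lambda>l. w l (z i)))"
  have "psd_mat (pick_mat k r n z W)"
    unfolding W_def by (rule pick_mat_row_psd[OF kernel_psd w]) (use z in auto)
  moreover have "\<forall>i<n. W i \<in> carrier_mat r r" by (simp add: W_def row_matrix_carrier)
  ultimately obtain \<Phi> where \<Phi>: "contractive_mult_mat H ip r \<Phi>"
    and int: "\<And>i. i < n \<Longrightarrow> map_mat (\<lambda>\<phi>. \<phi> (z i)) \<Phi> = W i"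
    using pick unfolding complete_pick_def by blast
  define b where "b = (\<lambda>l. \<Phi> $$ (0, l))"
  have dim: "\<Phi> \<in> carrier_mat r r" using \<Phi> by (simp add: contractive_mult_mat_def)
  have "\<Phi> $$ (a, l) \<in> elements_mat \<Phi>" if "a < r" "l < r" for a l
    using dim that by (intro elements_matI[of _ r r]) auto
  then have mult: "\<Phi> $$ (a, l) \<in> Mult H" if "a < r" "l < r" for a l
    using \<Phi> that by (auto simp: contractive_mult_mat_def)
  have "contractive_row r b"
    unfolding contractive_row_def
  proof (intro allI impI conjI)
    fix g :: "nat \<Rightarrow> 'x \<Rightarrow> complex" assume g: "\<forall>l<r. g l \<in> H"
    have "(\<lambda>x. b l x * g l x) \<in> H" if "l < r" for l
      using mult[OF r that] g that by (auto simp: b_def Mult_def)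
    then show "(\<lambda>x. \<Sum>l<r. b l x * g l x) \<in> H" by (intro sum_mem) auto
    have "(hnorm ip (\<lambda>x. \<Sum>l<r. b l x * g l x))\<^sup>2
      \<le> (\<Sum>a<r. (hnorm ip (\<lambda>x. \<Sum>l<r. (\<Phi> $$ (a, l)) x * g l x))\<^sup>2)"
      using member_le_sum[of 0 "{..<r}" "\<lambda>a. (hnorm ip (\<lambda>x. \<Sum>l<r. (\<Phi> $$ (a, l)) x * g l x))\<^sup>2"] r
      by (simp add: b_def)
    also have "\<dots> \<le> (\<Sum>l<r. (hnorm ip (g l))\<^sup>2)"
      using \<Phi> g by (simp add: contractive_mult_mat_def)
    finally show "(hnorm ip (\<lambda>x. \<Sum>l<r. b l x * g l x))\<^sup>2 \<le> (\<Sum>l<r. (hnorm ip (g l))\<^sup>2)" .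
  qed
  moreover have "b l x = w l x" if lx: "l < r" "x \<in> S" for l x
  proof -
    obtain i where i: "i < n" "x = z i" using lx(2) unfolding z(2)[symmetric] by blast
    have "map_mat (\<lambda>\<phi>. \<phi> (z i)) \<Phi> $$ (0, l) = W i $$ (0, l)" using int[OF i(1)] by simp
    then show ?thesis using dim r lx i by (simp add: W_def row_matrix_def b_def)
  qed
  ultimately show ?thesis by blast
qed

text \<open>
  On each finite set the row agrees with a contractive row of multipliers, whose products with \<open>g\<close>
  have uniformly bounded norm.
\<close>

lemma contractive_row_if_psd:
  assumes b: "psd_on UNIV (\<lambda>x y. k x y * (1 - (\<Sum>l<r. b l x * cnj (b l y))))"
  shows "contractive_row r b"
  unfolding contractive_row_def
proof (intro allI impI, rule mem_if_finitely_interpolated)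
  fix g :: "nat \<Rightarrow> 'x \<Rightarrow> complex" and F :: "'x set"
  assume g: "\<forall>l<r. g l \<in> H" and F: "finite F"
  obtain \<beta> where \<beta>: "contractive_row r \<beta>" "\<And>l x. l < r \<Longrightarrow> x \<in> F \<Longrightarrow> \<beta> l x = b l x"
    using row_interpolation[OF F psd_on_mono[OF b]] by auto
  show "\<exists>h\<in>H. (\<forall>x\<in>F. h x = (\<Sum>l<r. b l x * g l x)) \<and> (hnorm ip h)\<^sup>2 \<le> (\<Sum>l<r. (hnorm ip (g l))\<^sup>2)"
    using \<beta>(1) g \<beta>(2) unfolding contractive_row_def
    by (intro bexI[of _ "\<lambda>x. \<Sum>l<r. \<beta> l x * g l x"]) (auto intro: sum.cong)
qed

lemma mult_if_psd:
  assumes "psd_on UNIV (\<lambda>x y. k x y * (1 - \<phi> x * cnj (\<phi> y)))"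
  shows "\<phi> \<in> Mult H"
proof -
  have "contractive_row 1 (\<lambda>_. \<phi>)" by (rule contractive_row_if_psd) (use assms in simp)
  then have "(\<lambda>x. \<phi> x * f x) \<in> H" if "f \<in> H" for f
    using that unfolding contractive_row_def by (elim allE[of _ "\<lambda>_. f"]) auto
  then show ?thesis by (simp add: Mult_def)
qed

text \<open>
  The row maps tuples of functions vanishing at \<open>p\<close> to functions vanishing at \<open>p\<close>, and contractively
  so. The subspace of these functions has the kernel functions \<open>\<kappa> y\<close> below, and positivity is
  contractivity of the adjoint, \<open>\<kappa> y \<mapsto> (cnj (b l y) \<kappa> y)\<close> for \<open>l < r\<close>, on linear combinations of
  kernel functions.
\<close>

lemma compression_psd:
  assumes b: "contractive_row r b"
  shows "psd_on T (\<lambda>x y. (k x y - k x p * k p y / k p p) * (1 - (\<Sum>l<r. b l x * cnj (b l y))))"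
proof (rule psd_onI)
  fix F c assume F: "finite F" "F \<subseteq> T"
  define \<kappa> where "\<kappa> = (\<lambda>y z. k z y - (k p y / k p p) * k z p)"
  have \<kappa>H: "\<kappa> y \<in> H" for y unfolding \<kappa>_def by (intro diff_mem kernel_mem scale_mem)
  have \<kappa>p: "\<kappa> y p = 0" for y using diag[of p] by (simp add: \<kappa>_def)
  have rep: "ip h (\<kappa> y) = h y" if "h \<in> H" "h p = 0" for h y
    unfolding \<kappa>_def ip_diff_right[OF that(1) kernel_mem scale_mem[OF kernel_mem]]
      ip_scale_right[OF that(1) kernel_mem] reproducing[OF that(1), symmetric] that(2) by simp
  define K where "K = (\<lambda>x y. k x y - k x p * k p y / k p p)"
  have gram: "K = (\<lambda>x y. ip (\<kappa> y) (\<kappa> x))"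
    using rep[OF \<kappa>H \<kappa>p] by (intro ext) (simp add: K_def \<kappa>_def)
  define Y where "Y = (\<lambda>z. \<Sum>x\<in>F. c x * \<kappa> x z)"
  define G where "G = (\<lambda>l z. \<Sum>x\<in>F. (c x * cnj (b l x)) * \<kappa> x z)"
  define U where "U = (\<lambda>z. \<Sum>l<r. b l z * G l z)"
  define s where "s = (\<Sum>l<r. (hnorm ip (G l))\<^sup>2)"
  have YH: "Y \<in> H" and GH: "G l \<in> H" for l
    unfolding Y_def G_def by (intro sum_mem scale_mem \<kappa>H)+
  have Gp: "G l p = 0" for l by (simp add: G_def \<kappa>p)
  have UH: "U \<in> H" and Us: "(hnorm ip U)\<^sup>2 \<le> s"
    using b GH unfolding contractive_row_def U_def s_def by blast+
  have Up: "U p = 0" by (simp add: U_def Gp)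
  \<comment> \<open>\<open>G\<close> is the adjoint of the row applied to \<open>Y\<close>, and \<open>U\<close> is the row applied to \<open>G\<close>\<close>
  have "ip U Y = (\<Sum>x\<in>F. cnj (c x) * U x)"
    unfolding Y_def
    by (subst ip_sum_right) (auto simp: UH scale_mem \<kappa>H ip_scale_right rep[OF UH Up])
  also have "\<dots> = (\<Sum>x\<in>F. \<Sum>l<r. cnj (c x) * b l x * ip (G l) (\<kappa> x))"
    by (simp add: U_def sum_distrib_left rep[OF GH Gp] mult.assoc)
  also have "\<dots> = (\<Sum>l<r. \<Sum>x\<in>F. cnj (c x) * b l x * ip (G l) (\<kappa> x))" by (rule sum.swap)
  also have "\<dots> = (\<Sum>l<r. ip (G l) (G l))"
  proof (rule sum.cong[OF refl])
    fix l
    have "ip (G l) (\<lambda>z. \<Sum>x\<in>F. (c x * cnj (b l x)) * \<kappa> x z)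
        = (\<Sum>x\<in>F. cnj (c x) * b l x * ip (G l) (\<kappa> x))"
      by (subst ip_sum_right) (auto simp: GH scale_mem \<kappa>H ip_scale_right)
    then show "(\<Sum>x\<in>F. cnj (c x) * b l x * ip (G l) (\<kappa> x)) = ip (G l) (G l)"
      by (simp add: G_def)
  qed
  finally have UY: "ip U Y = of_real s" by (simp add: s_def ip_self GH)
  have s0: "0 \<le> s" by (simp add: s_def sum_nonneg)
  then have "s \<le> hnorm ip U * hnorm ip Y" using cauchy_schwarz[OF UH YH] UY by simp
  then have "s * s \<le> (hnorm ip U * hnorm ip Y) * (hnorm ip U * hnorm ip Y)"
    by (intro mult_mono) (use s0 in auto)
  also have "\<dots> = (hnorm ip U)\<^sup>2 * (hnorm ip Y)\<^sup>2" by (simp add: power2_eq_square)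
  also have "\<dots> \<le> s * (hnorm ip Y)\<^sup>2" using Us by (rule mult_right_mono) simp
  finally have le: "s \<le> (hnorm ip Y)\<^sup>2" using s0 by (cases "s = 0") auto
  have "qform F c (\<lambda>x y. K x y * (1 - (\<Sum>l<r. b l x * cnj (b l y))))
    = qform F c K - (\<Sum>l<r. qform F (\<lambda>x. c x * cnj (b l x)) K)"
  proof -
    have "(\<Sum>l<r. qform F (\<lambda>x. c x * cnj (b l x)) K)
      = (\<Sum>x\<in>F. \<Sum>y\<in>F. \<Sum>l<r. cnj (c x * cnj (b l x)) * (c y * cnj (b l y)) * K x y)"
      unfolding qform_def by (subst sum.swap, intro sum.cong refl sum.swap)
    then show ?thesis unfolding qform_def
      by (simp add: sum_subtractf[symmetric] right_diff_distrib sum_distrib_left mult_ac)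
  qed
  also have "\<dots> = of_real ((hnorm ip Y)\<^sup>2 - s)"
    unfolding gram qform_gram[OF \<kappa>H] s_def Y_def G_def by simp
  also have "0 \<le> \<dots>" using le by (simp add: less_eq_complex_def)
  finally show "0 \<le> qform F c (\<lambda>x y. (k x y - k x p * k p y / k p p) * (1 - (\<Sum>l<r. b l x * cnj (b l y))))"
    by (simp add: K_def)
qed

end

section \<open>The kernel has no zeros and base points can be changed\<close>

locale normalized_complete_pick_space = complete_pick_space H ip k
  for H :: "('x \<Rightarrow> complex) set" and ip k +
  fixes x0 :: 'x
  assumes normalized: "k x x0 = 1"
begin

lemma kernel_hermitian: "k y x = cnj (k x y)"
  by (rule psd_on_hermitian[OF kernel_psd[of UNIV]]) auto

lemma kernel_base [simp]: "k x x0 = 1" "k x0 x = 1"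
  using normalized[of x] kernel_hermitian[of x0 x] by auto

lemma kernel_diag: obtains d where "k x x = complex_of_real d" "d \<ge> 1"
proof -
  have "psd_on UNIV (\<lambda>x y. k x y - k x x0 * k x0 y / k x0 x0)"
    by (rule schur_complement[OF kernel_psd]) simp
  from psd_on_diag_nonneg[OF this, of x] have "1 \<le> k x x" by simp
  then have "k x x = complex_of_real (Re (k x x))" "Re (k x x) \<ge> 1"
    by (auto simp: less_eq_complex_def complex_eq_iff)
  then show ?thesis by (rule that)
qed

text \<open>
  If \<open>k x y = 0\<close>, then the values \<open>1\<close> at \<open>x\<close> and \<open>-1\<close> at \<open>y\<close> have the zero matrix as Pick matrix,
  so some contractive multiplier interpolates them. On the functions vanishing at \<open>x0\<close>, whose kernel
  is \<open>k - 1\<close>, its Pick matrix has zero diagonal and off-diagonal entries \<open>-2\<close>, and is not positive.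
\<close>

lemma kernel_nonzero: "k x y \<noteq> 0"
proof
  assume 0: "k x y = 0"
  then have xy: "x \<noteq> y" using diag by auto
  have zero': "k y x = 0" using kernel_hermitian[of y x] 0 by simp
  define w :: "nat \<Rightarrow> 'x \<Rightarrow> complex" where "w = (\<lambda>l z. if z = x then 1 else - 1)"
  have "psd_on {x, y} (\<lambda>u v. k u v * (1 - (\<Sum>l<1. w l u * cnj (w l v))))"
    by (rule psd_on_cong[OF psd_on_zero]) (use 0 zero' xy in \<open>auto simp: w_def\<close>)
  then obtain b where b: "contractive_row 1 b" "\<And>l u. l < 1 \<Longrightarrow> u \<in> {x, y} \<Longrightarrow> b l u = w l u"
    using row_interpolation[where S = "{x, y}" and r = 1 and w = w] by auto
  have "0 \<le> qform {x, y} (\<lambda>_. 1)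
      (\<lambda>u v. (k u v - k u x0 * k x0 v / k x0 x0) * (1 - (\<Sum>l<1. b l u * cnj (b l v))))"
    by (rule psd_onD[OF compression_psd[OF b(1), of UNIV]]) auto
  also have "\<dots> = - 4" using xy 0 zero' by (simp add: qform_def b(2) w_def)
  finally show False by (simp add: less_eq_complex_def)
qed

text \<open>
  Factoring the kernel of the hypothesis as \<open>\<Sum>l. b l x * cnj (b l y)\<close> gives a row with
  \<open>k(x, y) (1 - \<Sum>l. b l x * cnj (b l y)) = k(x, p) k(p, y) / k(p, p)\<close>. This has rank one and is
  positive, so the row can be interpolated. Compressing the interpolating row to functions vanishing
  at \<open>q\<close> and dividing by the rank-one kernel yields the conclusion.
\<close>

lemma change_of_base:
  assumes S: "finite S" and p: "psd_on S (\<lambda>x y. 1 - k x p * k p y / (k p p * k x y))"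
  shows "psd_on S (\<lambda>x y. 1 - k x q * k q y / (k q q * k x y))"
proof -
  obtain r b where b: "\<And>x y. x \<in> S \<Longrightarrow> y \<in> S \<Longrightarrow>
      1 - k x p * k p y / (k p p * k x y) = (\<Sum>l<(r::nat). b l x * cnj (b l y))"
    using partial_factorization[OF p S order_refl] by blast
  obtain d where d: "k p p = complex_of_real d" "d \<ge> 1" by (rule kernel_diag)
  have "psd_on S (\<lambda>x y. of_real (1 / d) * (k x p * cnj (k y p)))"
    by (intro psd_on_scale psd_on_rank_one) (use d in auto)
  then have "psd_on S (\<lambda>x y. k x y * (1 - (\<Sum>l<r. b l x * cnj (b l y))))"
    by (rule psd_on_cong) (simp add: b[symmetric] kernel_nonzero d(1) kernel_hermitian[symmetric])
  from row_interpolation[OF S this] obtain \<beta>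
    where \<beta>: "contractive_row r \<beta>" "\<And>l x. l < r \<Longrightarrow> x \<in> S \<Longrightarrow> \<beta> l x = b l x" by blast
  have "psd_on S (\<lambda>x y. (k x y - k x q * k q y / k q q) * (1 - (\<Sum>l<r. \<beta> l x * cnj (\<beta> l y))))"
    by (rule compression_psd[OF \<beta>(1)])
  then have "psd_on S (\<lambda>x y. (1 / k x p) * ((k x y - k x q * k q y / k q q)
      * (1 - (\<Sum>l<r. \<beta> l x * cnj (\<beta> l y)))) * cnj (1 / k y p))"
    by (rule psd_on_congruence)
  then have "psd_on S (\<lambda>x y. of_real d * ((1 / k x p) * ((k x y - k x q * k q y / k q q)
      * (1 - (\<Sum>l<r. \<beta> l x * cnj (\<beta> l y)))) * cnj (1 / k y p)))"
    by (rule psd_on_scale) (use d in simp)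
  then show ?thesis
  proof (rule psd_on_cong)
    fix x y assume xy: "x \<in> S" "y \<in> S"
    have defect: "1 - (\<Sum>l<r. \<beta> l x * cnj (\<beta> l y)) = k x p * k p y / (k p p * k x y)"
      using b[OF xy] \<beta>(2) xy by (simp add: diff_eq_eq add.commute)
    have inv: "cnj (1 / k y p) = 1 / k p y" using kernel_hermitian[of p y] by simp
    show "of_real d * ((1 / k x p) * ((k x y - k x q * k q y / k q q)
      * (1 - (\<Sum>l<r. \<beta> l x * cnj (\<beta> l y)))) * cnj (1 / k y p))
      = 1 - k x q * k q y / (k q q * k x y)"
      unfolding d(1)[symmetric] defect inv by (simp add: kernel_nonzero field_simps)
  qed
qed

text \<open>
  With base point \<open>y\<close>, the row and the column of \<open>y\<close> are zero, so \<open>y\<close> can be added to the set;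
  afterwards the base point is moved from \<open>y\<close> to \<open>q\<close>.
\<close>

lemma base_psd:
  assumes "finite S"
  shows "psd_on S (\<lambda>x y. 1 - k x q * k q y / (k q q * k x y))"
  using assms
proof (induction S arbitrary: q rule: finite_induct)
  case empty
  show ?case by (simp add: psd_on_def qform_def)
next
  case (insert y S)
  have "psd_on (insert y S) (\<lambda>u v. 1 - k u y * k y v / (k y y * k u v))"
    by (rule psd_on_insert_zero[OF insert.IH]) (simp_all add: kernel_nonzero)
  then show ?case by (rule change_of_base[rotated]) (use insert in simp)
qed

section \<open>The positive kernel 1 - 1/k\<close>

text \<open>
  The kernel of McCullough and Quiggin: with \<open>L x y = \<Sum>_i b_i(x) cnj (b_i(y))\<close>, the kernel
  \<open>k = 1 / (1 - L)\<close> is the Drury--Arveson kernel pulled back along \<open>b\<close>.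
\<close>

definition L :: "'x \<Rightarrow> 'x \<Rightarrow> complex"
  where "L x y = 1 - 1 / k x y"

lemma L_psd: "psd_on T L"
proof (rule psd_on_finite_subsets)
  fix F :: "'x set" assume "finite F"
  from base_psd[OF this, of x0] show "psd_on F L" by (simp add: L_def[abs_def])
qed

lemma kernel_L: "k x y * (1 - L x y) = 1"
  by (simp add: L_def kernel_nonzero)

lemma kernel_times_L: "k x y * L x y = k x y - 1"
  by (simp add: L_def kernel_nonzero right_diff_distrib)

text \<open>
  This is contractivity of the row \<open>(b_i)_i\<close> with \<open>L = \<Sum>_i b_i cnj (b_i)\<close>, applied to the tuple
  \<open>G_i = \<Sum>w\<in>S. cnj (b_i(w)) g_w\<close> and expressed through \<open>L\<close> alone. Only the columns \<open>w \<in> S\<close> of \<open>L\<close>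
  occur, so finitely many \<open>b_i\<close> suffice; the positive remainder \<open>L - \<Sum>_i b_i cnj (b_i)\<close> only helps.
\<close>

lemma L_row_contractive:
  assumes S: "finite S" and g: "\<And>w. w \<in> S \<Longrightarrow> g w \<in> H"
  shows "(\<lambda>x. \<Sum>w\<in>S. L x w * g w x) \<in> H"
    and "complex_of_real ((hnorm ip (\<lambda>x. \<Sum>w\<in>S. L x w * g w x))\<^sup>2)
      \<le> (\<Sum>z\<in>S. \<Sum>w\<in>S. L z w * ip (g w) (g z))"
proof -
  obtain r b where psd: "psd_on UNIV (\<lambda>x y. L x y - (\<Sum>l<(r::nat). b l x * cnj (b l y)))"
    and eq: "\<And>x y. y \<in> S \<Longrightarrow> L x y = (\<Sum>l<r. b l x * cnj (b l y))"
    using partial_factorization[OF L_psd[of UNIV] S] by auto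
  have "psd_on UNIV (\<lambda>x y. 1 + k x y * (L x y - (\<Sum>l<r. b l x * cnj (b l y))))"
    by (intro psd_on_add psd_on_one schur_product kernel_psd psd)
  then have "psd_on UNIV (\<lambda>x y. k x y * (1 - (\<Sum>l<r. b l x * cnj (b l y))))"
    by (rule psd_on_cong) (simp add: kernel_times_L right_diff_distrib)
  then have row: "contractive_row r b" by (rule contractive_row_if_psd)
  define G where "G = (\<lambda>l x. \<Sum>w\<in>S. cnj (b l w) * g w x)"
  have GH: "G l \<in> H" for l unfolding G_def by (intro sum_mem scale_mem g)
  have Y: "(\<lambda>x. \<Sum>l<r. b l x * G l x) = (\<lambda>x. \<Sum>w\<in>S. L x w * g w x)"
  proof
    fix x
    have "(\<Sum>l<r. b l x * G l x) = (\<Sum>l<r. \<Sum>w\<in>S. b l x * cnj (b l w) * g w x)"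
      by (simp add: G_def sum_distrib_left mult.assoc)
    also have "\<dots> = (\<Sum>w\<in>S. \<Sum>l<r. b l x * cnj (b l w) * g w x)" by (rule sum.swap)
    also have "\<dots> = (\<Sum>w\<in>S. L x w * g w x)" by (simp add: eq sum_distrib_right)
    finally show "(\<Sum>l<r. b l x * G l x) = (\<Sum>w\<in>S. L x w * g w x)" .
  qed
  have bound: "(\<lambda>x. \<Sum>w\<in>S. L x w * g w x) \<in> H \<and>
      (hnorm ip (\<lambda>x. \<Sum>w\<in>S. L x w * g w x))\<^sup>2 \<le> (\<Sum>l<r. (hnorm ip (G l))\<^sup>2)"
    using row GH unfolding contractive_row_def Y[symmetric] by blast
  have total: "complex_of_real (\<Sum>l<r. (hnorm ip (G l))\<^sup>2) = (\<Sum>z\<in>S. \<Sum>w\<in>S. L z w * ip (g w) (g z))"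
  proof -
    have "complex_of_real (\<Sum>l<r. (hnorm ip (G l))\<^sup>2)
        = (\<Sum>l<r. qform S (\<lambda>w. cnj (b l w)) (\<lambda>z w. ip (g w) (g z)))"
      unfolding G_def by (simp only: of_real_sum qform_gram[OF g])
    also have "\<dots> = (\<Sum>z\<in>S. \<Sum>w\<in>S. \<Sum>l<r. b l z * cnj (b l w) * ip (g w) (g z))"
      unfolding qform_def complex_cnj_cnj by (subst sum.swap, intro sum.cong refl sum.swap)
    also have "\<dots> = (\<Sum>z\<in>S. \<Sum>w\<in>S. L z w * ip (g w) (g z))"
      by (intro sum.cong refl) (simp add: eq sum_distrib_right)
    finally show ?thesis .
  qed
  show "(\<lambda>x. \<Sum>w\<in>S. L x w * g w x) \<in> H" using bound by blast
  show "complex_of_real ((hnorm ip (\<lambda>x. \<Sum>w\<in>S. L x w * g w x))\<^sup>2)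
      \<le> (\<Sum>z\<in>S. \<Sum>w\<in>S. L z w * ip (g w) (g z))"
    unfolding total[symmetric] using bound
    by (simp add: less_eq_complex_def del: of_real_power of_real_sum)
qed

lemma L_diag: obtains t where "L x x = complex_of_real t" "0 \<le> t" "t < 1"
proof -
  obtain d where d: "k x x = complex_of_real d" "d \<ge> 1" by (rule kernel_diag)
  have "L x x = complex_of_real (1 - 1 / d)" by (simp add: L_def d)
  then show ?thesis using d by (intro that[of "1 - 1 / d"]) auto
qed

text \<open>
  Multiplication by \<open>L_w = L(\<cdot>, w)\<close> has squared norm at most \<open>t = L w w < 1\<close>, so \<open>1 - L_w = 1/k_w\<close> is
  bounded below, and inverting it gives a bounded operator. On the level of kernels, the lower bound is
  positivity of \<open>k(x, y) ((1 - L_w(x)) (1 - cnj (L_w(y))) - \<delta>)\<close> for some \<open>\<delta> > 0\<close>, and multiplying by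
  \<open>k_w(x) cnj (k_w(y))\<close> turns this into contractivity of \<open>sqrt \<delta> k_w\<close>.
\<close>

lemma kernel_mult: "(\<lambda>x. k x w) \<in> Mult H"
proof -
  obtain t where t: "L w w = complex_of_real t" "0 \<le> t" "t < 1" by (rule L_diag)
  have herm: "L w y = cnj (L y w)" for y
    by (rule psd_on_hermitian[OF L_psd[of UNIV]]) auto
  have "psd_on UNIV (\<lambda>x y. of_real t * (L x y - L x w * L w y / L w w))"
    by (intro psd_on_scale schur_complement L_psd) (use t in auto)
  then have "psd_on UNIV (\<lambda>x y. of_real t * L x y - L x w * cnj (L y w))"
  proof (rule psd_on_cong)
    fix x y
    show "of_real t * (L x y - L x w * L w y / L w w) = of_real t * L x y - L x w * cnj (L y w)"
    proof (cases "t = 0")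
      case True
      then show ?thesis using psd_on_diag_zero(1)[OF L_psd[of UNIV], of x w] t by simp
    next
      case False
      then show ?thesis by (simp add: t(1) herm[of y] right_diff_distrib)
    qed
  qed
  then have "psd_on UNIV (\<lambda>x y. of_real t * 1 + k x y * (of_real t * L x y - L x w * cnj (L y w)))"
    by (intro psd_on_add psd_on_scale psd_on_one schur_product kernel_psd) (use t in auto)
  then have P: "psd_on UNIV (\<lambda>x y. k x y * (of_real t - L x w * cnj (L y w)))"
  proof (rule psd_on_cong)
    fix x y
    define c where "c = L x w * cnj (L y w)"
    have "of_real t * 1 + k x y * (of_real t * L x y - c) = of_real t * (1 + k x y * L x y) - k x y * c"
      by (simp add: algebra_simps)
    also have "\<dots> = k x y * (of_real t - c)"
      unfolding kernel_times_L by (simp add: algebra_simps)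
    finally show "of_real t * 1 + k x y * (of_real t * L x y - L x w * cnj (L y w))
        = k x y * (of_real t - L x w * cnj (L y w))"
      by (simp only: c_def)
  qed
  \<comment> \<open>completing the square: with \<open>u = L_w(x)\<close>, \<open>v = cnj (L_w(y))\<close> and any \<open>a\<close> between \<open>t\<close> and \<open>1\<close>,
    \<open>(1 - u) (1 - v) - \<delta> = (a - u) (a - v) / a + (1/a - 1) (t - u v)\<close>\<close>
  define a where "a = (1 + t) / 2"
  have a: "0 < a" "a < 1" "t < a" using t by (auto simp: a_def)
  define \<delta> where "\<delta> = (1 - a) * (1 - t / a)"
  have \<delta>: "0 < \<delta>" using a t by (simp add: \<delta>_def)
  have "psd_on UNIV (\<lambda>x y. of_real (1 / a) * ((of_real a - L x w) * k x y * cnj (of_real a - L y w))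
      + of_real (1 / a - 1) * (k x y * (of_real t - L x w * cnj (L y w))))"
    by (intro psd_on_add psd_on_scale psd_on_congruence kernel_psd P) (use a in auto)
  then have "psd_on UNIV (\<lambda>x y. k x w * (of_real (1 / a) * ((of_real a - L x w) * k x y * cnj (of_real a - L y w))
      + of_real (1 / a - 1) * (k x y * (of_real t - L x w * cnj (L y w)))) * cnj (k y w))"
    by (rule psd_on_congruence)
  then have "psd_on UNIV (\<lambda>x y. k x y * (1 - (of_real (sqrt \<delta>) * k x w) * cnj (of_real (sqrt \<delta>) * k y w)))"
  proof (rule psd_on_cong)
    fix x y
    define u v where "u = L x w" and "v = cnj (L y w)"
    have split: "of_real (1 / a) * ((of_real a - u) * k x y * (of_real a - v))
        + of_real (1 / a - 1) * (k x y * (of_real t - u * v)) = k x y * ((1 - u) * (1 - v) - of_real \<delta>)"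
    proof -
      define A I T where "A = complex_of_real a" and "I = complex_of_real (1 / a)" and "T = complex_of_real t"
      have IA: "I * A = 1" using a by (simp add: I_def A_def)
      have "I * ((A - u) * k x y * (A - v)) + (I - 1) * (k x y * (T - u * v))
          = k x y * ((I * A) * A - (I * A) * (u + v) + u * v - T + I * T)"
        by (simp add: algebra_simps)
      also have "\<dots> = k x y * ((1 - u) * (1 - v) - (1 - A - I * T + (I * A) * T))"
        unfolding IA by (simp add: algebra_simps)
      finally have 1: "I * ((A - u) * k x y * (A - v)) + (I - 1) * (k x y * (T - u * v))
          = k x y * ((1 - u) * (1 - v) - (1 - A - I * T + (I * A) * T))" .
      have "complex_of_real \<delta> = (1 - A) * (1 - I * T)" by (simp add: \<delta>_def A_def I_def T_def)
      also have "\<dots> = 1 - A - I * T + (I * A) * T" by (simp add: algebra_simps)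
      finally have 2: "1 - A - I * T + (I * A) * T = complex_of_real \<delta>" by (rule sym)
      have 3: "complex_of_real (1 / a - 1) = I - 1" by (simp add: I_def)
      show ?thesis using 1 unfolding 2 unfolding 3 A_def I_def T_def .
    qed
    have ku: "k x w * (1 - u) = 1" by (simp add: u_def kernel_L)
    have kv: "cnj (k y w) * (1 - v) = 1"
      using arg_cong[OF kernel_L[of y w], of cnj] by (simp add: v_def)
    have sq: "complex_of_real (sqrt \<delta>) * of_real (sqrt \<delta>) = of_real \<delta>"
      using \<delta> by (simp flip: of_real_mult)
    have "k x w * (k x y * ((1 - u) * (1 - v) - of_real \<delta>)) * cnj (k y w)
      = k x y * ((k x w * (1 - u)) * (cnj (k y w) * (1 - v)) - of_real \<delta> * k x w * cnj (k y w))"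
      by (simp add: algebra_simps)
    also have "\<dots> = k x y * (1 - (of_real (sqrt \<delta>) * k x w) * cnj (of_real (sqrt \<delta>) * k y w))"
      unfolding ku kv sq[symmetric] by (simp add: mult_ac)
    finally show "k x w * (of_real (1 / a) * ((of_real a - L x w) * k x y * cnj (of_real a - L y w))
      + of_real (1 / a - 1) * (k x y * (of_real t - L x w * cnj (L y w)))) * cnj (k y w)
      = k x y * (1 - (of_real (sqrt \<delta>) * k x w) * cnj (of_real (sqrt \<delta>) * k y w))"
      using split by (simp add: u_def v_def)
  qed
  then have m: "(\<lambda>x. of_real (sqrt \<delta>) * k x w) \<in> Mult H" by (rule mult_if_psd)
  have "(\<lambda>x. k x w * f x) \<in> H" if "f \<in> H" for f
  proof -
    have "(\<lambda>x. of_real (sqrt \<delta>) * k x w * f x) \<in> H" using m that by (simp add: Mult_def)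
    from scale_mem[OF this, of "1 / of_real (sqrt \<delta>)"] show ?thesis using \<delta> by (simp add: mult.assoc)
  qed
  then show ?thesis by (simp add: Mult_def)
qed

section \<open>Elements of the space as quotients of multipliers\<close>

lemma one_mem: "(\<lambda>x. 1) \<in> H"
  using kernel_mem[of x0] by simp

text \<open>
  Let \<open>F w = k_w f\<close>. Since \<open>L_w F_w = F_w - f\<close>, contractivity of multiplication by \<open>L_w\<close> gives
  \<open>\<parallel>F_w - f\<parallel> \<le> \<parallel>F_w\<parallel>\<close>, which is the bound on \<open>s\<close>. The multiplier is found by solving for the transfer
  function of the isometry \<open>k_w \<mapsto> 1 \<oplus> (cnj (b_i(w)) k_w)_i\<close>, where the decomposition
  \<open>k_w = cnj (f(w)) f + (k_w - cnj (f(w)) f)\<close> is orthogonal because \<open>\<parallel>f\<parallel> = 1\<close>. The resolvent involved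
  is a rank-one perturbation of multiplication by \<open>k_w\<close>, which is why \<open>\<phi> = f / s\<close> has a closed form.
\<close>

lemma unit_vector_quotient:
  assumes f: "f \<in> H" and norm: "hnorm ip f = 1"
  defines "s \<equiv> \<lambda>w. ip f (\<lambda>x. k x w * f x)"
  shows "1 \<le> 2 * Re (s w)" and "(\<lambda>w. f w / s w) \<in> Mult H"
proof -
  define F where "F = (\<lambda>w x. k x w * f x)"
  have FH: "F w \<in> H" for w using kernel_mult f by (simp add: Mult_def F_def)
  have s: "ip (F w) f = cnj (s w)" for w using ip_commute[OF f FH] by (simp add: s_def F_def)
  have ff: "ip f f = 1" using ip_self[OF f] norm by simp
  have LF: "L x w * F w x = F w x - f x" for x w
    by (simp add: L_def F_def kernel_nonzero left_diff_distrib)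
  have re: "1 \<le> 2 * Re (s w)" for w
  proof -
    obtain t where t: "L w w = complex_of_real t" "0 \<le> t" "t < 1" by (rule L_diag)
    have "complex_of_real ((hnorm ip (\<lambda>x. F w x - f x))\<^sup>2) \<le> L w w * ip (F w) (F w)"
      using L_row_contractive(2)[of "{w}" F] FH by (simp add: LF)
    then have "(hnorm ip (\<lambda>x. F w x - f x))\<^sup>2 \<le> t * (hnorm ip (F w))\<^sup>2"
      by (simp add: t(1) ip_self[OF FH] less_eq_complex_def del: of_real_power)
    also have "\<dots> \<le> 1 * (hnorm ip (F w))\<^sup>2" using t by (intro mult_right_mono) auto
    finally show ?thesis using hnorm_sq_diff[OF FH f, of w] norm s[of w] by simp
  qed
  show "1 \<le> 2 * Re (s w)" by (rule re)
  have s0: "s w \<noteq> 0" for w using re[of w] by auto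
  define \<phi> where "\<phi> = (\<lambda>w. f w / s w)"
  define E where "E = (\<lambda>w x. k x w - cnj (\<phi> w) * F w x)"
  have EH: "E w \<in> H" for w unfolding E_def by (intro diff_mem kernel_mem scale_mem FH)
  have Ef: "ip (E w) f = 0" for w
  proof -
    have "ip (\<lambda>x. k x w) f = cnj (f w)" using ip_commute[OF f kernel_mem] reproducing[OF f] by simp
    then have "ip (E w) f = cnj (f w) - cnj (\<phi> w) * cnj (s w)"
      unfolding E_def by (simp add: ip_diff_left kernel_mem scale_mem FH f ip_scale s)
    then show ?thesis using s0[of w] by (simp add: \<phi>_def)
  qed
  have LE: "1 + L x w * E w x = E w x + cnj (\<phi> w) * f x" for x w
  proof -
    have "L x w * E w x = (k x w * L x w) * (1 - cnj (\<phi> w) * f x)"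
      by (simp add: E_def F_def algebra_simps)
    then show ?thesis unfolding kernel_times_L by (simp add: E_def F_def algebra_simps)
  qed
  define A where "A = (\<lambda>w x. E w x + cnj (\<phi> w) * f x)"
  have A: "A w x = 1 + L x w * E w x" for w x by (simp only: A_def LE)
  have AH: "A w \<in> H" for w unfolding A_def by (intro add_mem scale_mem EH f)
  have AA: "ip (A w) (A z) = ip (E w) (E z) + \<phi> z * cnj (\<phi> w)" for w z
    using Ef[of w] Ef[of z] ip_commute[OF EH f, of z]
    by (simp add: A_def ip_add ip_add_right ip_scale ip_scale_right EH f scale_mem add_mem ff)
  \<comment> \<open>compare the Gram kernel of \<open>A w = E w + cnj (\<phi> w) f\<close>, where the two terms are orthogonal,
    with the bound for \<open>A w = 1 + L_w E w\<close>, where \<open>1 = k_{x0}\<close> is orthogonal to \<open>L_w E w\<close>\<close>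
  have "psd_on UNIV (\<lambda>z w. 1 - \<phi> z * cnj (\<phi> w) - (1 - L z w) * ip (E w) (E z))"
  proof (rule psd_onI)
    fix S :: "'x set" and c :: "'x \<Rightarrow> complex" assume S: "finite S"
    define C where "C = sum c S"
    define Y where "Y = (\<lambda>x. \<Sum>w\<in>S. L x w * (c w * E w x))"
    have YH: "Y \<in> H" and Yle: "complex_of_real ((hnorm ip Y)\<^sup>2)
        \<le> (\<Sum>z\<in>S. \<Sum>w\<in>S. L z w * ip (\<lambda>x. c w * E w x) (\<lambda>x. c z * E z x))"
      unfolding Y_def by (rule L_row_contractive[OF S scale_mem[OF EH]])+
    have C: "(\<lambda>x. C * 1) \<in> H" by (rule scale_mem[OF one_mem])
    have "ip Y (\<lambda>x. 1) = Y x0" using reproducing[OF YH, of x0] by simp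
    also have "\<dots> = 0" by (simp add: Y_def L_def)
    finally have "ip (\<lambda>x. C * 1) Y = 0"
      using ip_commute[OF YH one_mem] ip_scale[OF one_mem YH, of C] by simp
    moreover have "(hnorm ip (\<lambda>x. 1))\<^sup>2 = 1"
      using hnorm_sq[OF one_mem] reproducing[OF one_mem, of x0] by simp
    ultimately have h: "(hnorm ip (\<lambda>x. C * 1 + Y x))\<^sup>2 = (cmod C)\<^sup>2 + (hnorm ip Y)\<^sup>2"
      using hnorm_sq_add[OF C YH] hnorm_sq_scale[OF one_mem, of C] by simp
    have sum_A: "(\<lambda>x. C * 1 + Y x) = (\<lambda>x. \<Sum>w\<in>S. c w * A w x)"
      by (simp add: C_def Y_def A distrib_left sum.distrib mult_ac)
    have "qform S c (\<lambda>z w. ip (A w) (A z)) = of_real ((hnorm ip (\<lambda>x. \<Sum>w\<in>S. c w * A w x))\<^sup>2)"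
      by (rule qform_gram[OF AH])
    also have "\<dots> = of_real ((cmod C)\<^sup>2 + (hnorm ip Y)\<^sup>2)" by (simp only: sum_A[symmetric] h)
    also have "\<dots> = qform S c (\<lambda>z w. 1) + of_real ((hnorm ip Y)\<^sup>2)"
    proof -
      have "qform S c (\<lambda>z w. 1) = cnj C * C"
        unfolding qform_def C_def by (simp add: sum_product cnj_sum)
      also have "\<dots> = C * cnj C" by (rule mult.commute)
      finally have "qform S c (\<lambda>z w. 1) = C * cnj C" .
      then show ?thesis by (simp only: complex_norm_square of_real_add)
    qed
    also have "\<dots> \<le> qform S c (\<lambda>z w. 1) + qform S c (\<lambda>z w. L z w * ip (E w) (E z))"
    proof -
      have "(\<Sum>z\<in>S. \<Sum>w\<in>S. L z w * ip (\<lambda>x. c w * E w x) (\<lambda>x. c z * E z x))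
        = qform S c (\<lambda>z w. L z w * ip (E w) (E z))"
        unfolding qform_def
        by (intro sum.cong refl) (simp add: ip_scale ip_scale_right EH scale_mem mult_ac)
      from Yle[unfolded this] show ?thesis by (rule add_left_mono)
    qed
    finally have "0 \<le> qform S c (\<lambda>z w. 1) + qform S c (\<lambda>z w. L z w * ip (E w) (E z))
        - qform S c (\<lambda>z w. ip (A w) (A z))" by (simp only: diff_ge_0_iff_ge)
    also have "\<dots> = qform S c (\<lambda>z w. 1 - \<phi> z * cnj (\<phi> w) - (1 - L z w) * ip (E w) (E z))"
      unfolding qform_def AA sum.distrib[symmetric] sum_subtractf[symmetric]
      by (intro sum.cong refl) (simp add: algebra_simps)
    finally show "0 \<le> qform S c (\<lambda>z w. 1 - \<phi> z * cnj (\<phi> w) - (1 - L z w) * ip (E w) (E z))" .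
  qed
  then have "psd_on UNIV (\<lambda>z w. k z w * (1 - \<phi> z * cnj (\<phi> w) - (1 - L z w) * ip (E w) (E z))
      + ip (E w) (E z))"
    by (intro psd_on_add schur_product kernel_psd gram_psd EH)
  then have "psd_on UNIV (\<lambda>z w. k z w * (1 - \<phi> z * cnj (\<phi> w)))"
  proof (rule psd_on_cong)
    fix z w
    have "k z w * ((1 - L z w) * ip (E w) (E z)) = ip (E w) (E z)"
      using kernel_L[of z w] by (simp add: mult.assoc[symmetric])
    then show "k z w * (1 - \<phi> z * cnj (\<phi> w) - (1 - L z w) * ip (E w) (E z)) + ip (E w) (E z)
        = k z w * (1 - \<phi> z * cnj (\<phi> w))"
      by (simp only: right_diff_distrib[of "k z w" "1 - \<phi> z * cnj (\<phi> w)"]) simp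
  qed
  then show "(\<lambda>w. f w / s w) \<in> Mult H" unfolding \<phi>_def[symmetric] by (rule mult_if_psd)
qed

lemma mult_with_same_zeros:
  assumes f: "f \<in> H"
  shows "\<exists>\<phi>\<in>Mult H. {x. \<phi> x = 0} = {x. f x = 0}"
proof (cases "f = (\<lambda>x. 0)")
  case True
  have "(\<lambda>x. 0) \<in> Mult H" by (simp add: Mult_def zero_mem)
  then show ?thesis unfolding True by (intro bexI[of _ "\<lambda>x. 0"]) simp_all
next
  case False
  define n where "n = hnorm ip f"
  have "n \<noteq> 0"
  proof
    assume "n = 0"
    then have "ip f f = 0" unfolding ip_self[OF f] n_def by simp
    from ip_definite[OF f this] False show False by contradiction
  qed
  then have n: "n > 0" using hnorm_nonneg[OF f] by (simp add: n_def)
  define g where "g = (\<lambda>x. of_real (1 / n) * f x)"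
  have g: "g \<in> H" unfolding g_def by (rule scale_mem[OF f])
  have "(hnorm ip g)\<^sup>2 = 1"
    using n unfolding g_def hnorm_sq_scale[OF f] n_def[symmetric] norm_of_real
    by (simp add: power_divide)
  then have g1: "hnorm ip g = 1" using hnorm_nonneg[OF g] by (simp add: power2_eq_1_iff)
  define s where "s = (\<lambda>w. ip g (\<lambda>x. k x w * g x))"
  have re: "1 \<le> 2 * Re (s w)" for w unfolding s_def by (rule unit_vector_quotient(1)[OF g g1])
  have s0: "s w \<noteq> 0" for w
  proof
    assume "s w = 0"
    then show False using re[of w] by simp
  qed
  have "g w / s w = 0 \<longleftrightarrow> f w = 0" for w using s0[of w] n by (simp add: g_def)
  then have "{w. g w / s w = 0} = {x. f x = 0}" by simp
  moreover have "(\<lambda>w. g w / s w) \<in> Mult H" unfolding s_def by (rule unit_vector_quotient(2)[OF g g1])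
  ultimately show ?thesis by (intro bexI[of _ "\<lambda>w. g w / s w"])
qed

lemma Mult_subset: "Mult H \<subseteq> H"
proof
  fix \<phi> assume "\<phi> \<in> Mult H"
  then have "\<forall>f\<in>H. (\<lambda>x. \<phi> x * f x) \<in> H" by (simp add: Mult_def)
  from bspec[OF this one_mem] show "\<phi> \<in> H" by simp
qed

lemma Mult_times: "\<phi> \<in> Mult H \<Longrightarrow> \<psi> \<in> Mult H \<Longrightarrow> (\<lambda>x. \<phi> x * \<psi> x) \<in> Mult H"
  by (simp add: Mult_def mult.assoc)

text \<open>
  Point evaluations are continuous, so if \<open>\<psi> x = 0\<close>, then no product \<open>\<psi> f\<close> is close to the constant
  function \<open>1\<close>.
\<close>

lemma cyclic_nonzero:
  assumes "cyclic_multiplier H ip \<psi>"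
  shows "\<psi> x \<noteq> 0"
proof
  assume 0: "\<psi> x = 0"
  define \<kappa> where "\<kappa> = hnorm ip (\<lambda>z. k z x)"
  have \<kappa>: "0 \<le> \<kappa>" unfolding \<kappa>_def by (rule hnorm_nonneg[OF kernel_mem])
  obtain f where f: "f \<in> H" "hnorm ip (\<lambda>z. \<psi> z * f z - 1) < 1 / (1 + \<kappa>)"
  proof -
    have "\<forall>g\<in>H. \<forall>e>0. \<exists>f\<in>H. hnorm ip (\<lambda>z. \<psi> z * f z - g z) < e"
      using assms by (simp add: cyclic_multiplier_def)
    from bspec[OF this one_mem] have "\<exists>f\<in>H. hnorm ip (\<lambda>z. \<psi> z * f z - 1) < 1 / (1 + \<kappa>)"
      using \<kappa> by simp
    then show ?thesis using that by blast
  qed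
  have "(\<lambda>z. \<psi> z * f z - 1) \<in> H"
    using assms f(1) one_mem by (intro diff_mem) (auto simp: cyclic_multiplier_def Mult_def)
  from evaluation_bound[OF this, of x] have "1 \<le> hnorm ip (\<lambda>z. \<psi> z * f z - 1) * \<kappa>"
    by (simp add: 0 \<kappa>_def)
  also have "\<dots> \<le> (1 / (1 + \<kappa>)) * \<kappa>" using f(2) \<kappa> by (intro mult_right_mono) auto
  also have "\<dots> < 1" using \<kappa> by (simp add: field_simps)
  finally show False by simp
qed

end

section \<open>Zero sets\<close>

theorem corollary1p2:
  fixes H :: "('x \<Rightarrow> complex) set"
    and ip :: "('x \<Rightarrow> complex) \<Rightarrow> ('x \<Rightarrow> complex) \<Rightarrow> complex"
    and k :: "'x \<Rightarrow> 'x \<Rightarrow> complex"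
  assumes "rkhs H ip k"
    and "\<forall>x. k x x \<noteq> 0"
    and "normalized_kernel k"
    and "complete_pick H ip k"
  shows "{Z. zero_set H Z} = {Z. zero_set (Mult H) Z} \<and>
    {Z. zero_set (Mult H) Z} = {Z. zero_set (smirnov H ip) Z} \<and>
    (\<forall>Z1 Z2. zero_set H Z1 \<longrightarrow> zero_set H Z2 \<longrightarrow> zero_set H (Z1 \<union> Z2))"
proof -
  obtain x0 where x0: "\<And>x. k x x0 = 1" using assms(3) by (auto simp: normalized_kernel_def)
  interpret rkhs H ip k by fact
  interpret normalized_complete_pick_space H ip k x0
    by unfold_locales (use assms x0 in auto)
  have H: "zero_set H Z \<longleftrightarrow> zero_set (Mult H) Z" for Z
    using mult_with_same_zeros Mult_subset unfolding zero_set_def by blast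
  have smirnov: "zero_set (Mult H) Z \<longleftrightarrow> zero_set (smirnov H ip) Z" for Z
  proof
    assume "zero_set (Mult H) Z"
    then obtain \<phi> where \<phi>: "\<phi> \<in> Mult H" "{x. \<phi> x = 0} = Z" by (auto simp: zero_set_def)
    have "(\<lambda>x. 1) \<in> Mult H" by (simp add: Mult_def)
    moreover have "cyclic_multiplier H ip (\<lambda>x. 1)"
      unfolding cyclic_multiplier_def
    proof (intro conjI ballI allI impI)
      fix g and e :: real assume "g \<in> H" "0 < e"
      then show "\<exists>f\<in>H. hnorm ip (\<lambda>x. 1 * f x - g x) < e" by (intro bexI[of _ g]) auto
    qed fact
    ultimately have "(\<lambda>x. \<phi> x / 1) \<in> smirnov H ip"
      using \<phi>(1) unfolding smirnov_def mem_Collect_eq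
      by (intro exI[of _ \<phi>] exI[of _ "\<lambda>x. 1"]) auto
    then show "zero_set (smirnov H ip) Z" using \<phi>(2) by (auto simp: zero_set_def)
  next
    assume "zero_set (smirnov H ip) Z"
    then obtain \<phi> \<psi> where \<phi>: "\<phi> \<in> Mult H" and \<psi>: "cyclic_multiplier H ip \<psi>"
      and Z: "{x. \<phi> x / \<psi> x = 0} = Z" unfolding zero_set_def smirnov_def by blast
    have "{x. \<phi> x = 0} = Z" using cyclic_nonzero[OF \<psi>] Z by simp
    then show "zero_set (Mult H) Z" using \<phi> by (auto simp: zero_set_def)
  qed
  have "zero_set (Mult H) (Z1 \<union> Z2)" if Z: "zero_set (Mult H) Z1" "zero_set (Mult H) Z2" for Z1 Z2
  proof -
    obtain \<phi> \<psi> where "\<phi> \<in> Mult H" "\<psi> \<in> Mult H" "{x. \<phi> x = 0} = Z1" "{x. \<psi> x = 0} = Z2"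
      using Z by (auto simp: zero_set_def)
    then show ?thesis unfolding zero_set_def
      by (intro bexI[OF _ Mult_times[of \<phi> \<psi>]]) auto
  qed
  then show ?thesis using H smirnov by simp
qed

end
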